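(* Let $q\in(0,1)$, $\psi\in D_q$, $1\leqslant s\leqslant\infty$, $n,p\in\mathbb{N}$, $p\leqslant n$, $\beta\in\mathbb{R}$, and let $\omega(t)$ be an arbitrary modulus of continuity. Put $\varepsilon_{n-p+1}:=\sup_{k\geqslant n-p+1}\left|\frac{\psi(k+1)}{\psi(k)}-q\right|$. Then, as $n-p\to\infty$, $$\mathcal{E}(C^\psi_{\beta,s};V_{n,p})=\frac{\psi(n-p+1)}{p}\left(\frac{p\,\mathcal{E}(C^q_{\beta,s};V_{n,p})}{q^{n-p+1}}+O(1)\frac{\varepsilon_{n-p+1}}{(1-q)^2}\min\Big\{p,\frac{1}{1-q}\Big\}\right),$$ $$\mathcal{E}(C^\psi_{\beta}H_\omega;V_{n,p})=\frac{\psi(n-p+1)}{p}\left(\frac{p\,\mathcal{E}(C^q_{\beta}H_\omega;V_{n,p})}{q^{n-p+1}}+O(1)\,\omega\Big(\frac{1}{n-p+1}\Big)\frac{\varepsilon_{n-p+1}}{(1-q)^2}\min\Big\{p,\frac{1}{1-q}\Big\}\right),$$ where the quantities $O(1)$ are uniformly bounded in $n$, $p$, $q$, $s$, $\psi$, $\beta$ and $\omega$.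
   Context: Spaces. $L_s$ ($1\leqslant s<\infty$) is the space of $2\pi$-periodic functions with $\|f\|_s=\left(\int_0^{2\pi}|f(t)|^s\,dt\right)^{1/s}<\infty$; $L_\infty$ is the space of essentially bounded measurable $2\pi$-periodic functions with $\|f\|_\infty=\operatorname{ess\,sup}_t|f(t)|$; $C$ is the space of continuous $2\pi$-periodic functions with $\|f\|_C=\max_t|f(t)|$. $(\psi,\beta)$-derivative. Let $f\in L_1$ have Fourier series $\frac{a_0(f)}{2}+\sum_{k=1}^\infty(a_k(f)\cos kx+b_k(f)\sin kx)$, let $\psi(k)$, $k\in\mathbb{N}$, be a sequence of real numbers and $\beta\in\mathbb{R}$. If there is $\varphi\in L_1$ with Fourier series $\sum_{k=1}^\infty\frac{1}{\psi(k)}\left(a_k(f)\cos(kx+\frac{\beta\pi}{2})+b_k(f)\sin(kx+\frac{\beta\pi}{2})\right)$, then $\varphi$ is called the $(\psi,\beta)$-derivative of $f$, denoted $f^\psi_\beta$. For $\mathfrak{N}\subset L_1$, $L^\psi_\beta\mathfrak{N}$ is the set of $f\in L_1$ for which $f^\psi_\beta$ exists and belongs to $\mathfrak{N}$, and $C^\psi_\beta\mathfrak{N}=C\cap L^\psi_\beta\mathfrak{N}$. When $\psi(k)=q^k$, this class is denoted $C^q_\beta\mathfrak{N}$. The set $D_q$, $q\in(0,1)$, consists of the sequences $\psi(k)>0$, $k\in\mathbb{N}$, with $\lim_{k\to\infty}\psi(k+1)/\psi(k)=q$. Classes. $U_s^0=\{\varphi\in L_s:\|\varphi\|_s\leqslant1,\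 \int_0^{2\pi}\varphi(t)\,dt=0\}$, $C^\psi_{\beta,s}=C^\psi_\beta U_s^0$, $C^q_{\beta,s}=C^q_\beta U_s^0$. For a modulus of continuity $\omega$ (a continuous, nondecreasing, subadditive function on $[0,\infty)$ with $\omega(0)=0$), $H_\omega=\{\varphi\in C:\omega(\varphi;t)\leqslant\omega(t),\ t\geqslant0\}$, where $\omega(\varphi;t)=\sup_{|h|\leqslant t}\|\varphi(\cdot+h)-\varphi(\cdot)\|_C$. De la Vallée Poussin sums. $V_{n,p}(f;x)=\frac1p\sum_{k=n-p}^{n-1}S_k(f;x)$, where $S_k(f;x)$ is the $k$th partial sum (harmonics of order at most $k$) of the Fourier series of $f$. For a class $\mathfrak{M}\subset C$, $\mathcal{E}(\mathfrak{M};V_{n,p})=\sup_{f\in\mathfrak{M}}\|f(\cdot)-V_{n,p}(f;\cdot)\|_C$. Meaning of the asymptotic notation. The parameter $p=p(n)$ may vary with $n$. "As $n-p\to\infty$, with $O(1)$ uniformly bounded in the listed parameters" means: there is an absolute constant $K$ such that for each $q\in(0,1)$ and $\psi\in D_q$ there is $N=N(\psi,q)$ such that, for all $n,p$ with $p\leqslant n$ and $n-p\geqslant N$ and all values of the other parameters, the formula holds with a quantity $O(1)$ of absolute value at most $K$. *)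

theory Defs
  imports "HOL-Probability.Essential_Supremum"
begin

text \<open>
  \<open>2\<pi>\<close>-periodic functions are plain functions on the reals, not classes modulo equality almost
  everywhere. All suprema below are suprema of reals; for the sets to which they are applied in the
  main statement they are taken over nonempty sets that are bounded above.
\<close>

definition periodic_2pi :: "(real \<Rightarrow> real) \<Rightarrow> bool" where
  "periodic_2pi f \<longleftrightarrow> (\<forall>x. f (x + 2 * pi) = f x)"

definition L_space :: "ereal \<Rightarrow> (real \<Rightarrow> real) set" where
  "L_space s = {f. periodic_2pi f \<and> f \<in> borel_measurable lebesgue \<and>
     (if s = \<infinity> then esssup lebesgue (\<lambda>t. ereal \<bar>f t\<bar>) < \<infinity>
      else integrable (lebesgue_on {0..2 * pi}) (\<lambda>t. \<bar>f t\<bar> powr real_of_ereal s))}"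

definition L_norm :: "ereal \<Rightarrow> (real \<Rightarrow> real) \<Rightarrow> real" where
  "L_norm s f =
     (if s = \<infinity> then real_of_ereal (esssup lebesgue (\<lambda>t. ereal \<bar>f t\<bar>))
      else (\<integral>t. \<bar>f t\<bar> powr real_of_ereal s \<partial>lebesgue_on {0..2 * pi}) powr (1 / real_of_ereal s))"

definition C_space :: "(real \<Rightarrow> real) set" where
  "C_space = {f. periodic_2pi f \<and> continuous_on UNIV f}"

definition C_norm :: "(real \<Rightarrow> real) \<Rightarrow> real" where
  "C_norm f = (SUP t. \<bar>f t\<bar>)"

definition fourier_a :: "(real \<Rightarrow> real) \<Rightarrow> nat \<Rightarrow> real" where
  "fourier_a f k = (1 / pi) * (\<integral>t. f t * cos (real k * t) \<partial>lebesgue_on {0..2 * pi})"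

definition fourier_b :: "(real \<Rightarrow> real) \<Rightarrow> nat \<Rightarrow> real" where
  "fourier_b f k = (1 / pi) * (\<integral>t. f t * sin (real k * t) \<partial>lebesgue_on {0..2 * pi})"

text \<open>
  \<open>\<phi>\<close> is a \<open>(\<psi>,\<beta>)\<close>-derivative of \<open>f\<close>. That the Fourier series of \<open>\<phi>\<close> is the prescribed series is
  expressed harmonic by harmonic (the constant term being zero), as an identity of
  trigonometric polynomials of the single frequency \<open>k\<close>; no convergence is involved. Only the
  values \<open>\<psi> k\<close> with \<open>k \<ge> 1\<close> matter.
\<close>

definition is_psi_beta_derivative ::
  "(nat \<Rightarrow> real) \<Rightarrow> real \<Rightarrow> (real \<Rightarrow> real) \<Rightarrow> (real \<Rightarrow> real) \<Rightarrow> bool" where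
  "is_psi_beta_derivative \<psi> \<beta> f \<phi> \<longleftrightarrow>
     \<phi> \<in> L_space 1 \<and> fourier_a \<phi> 0 = 0 \<and>
     (\<forall>k\<ge>1. \<forall>x. fourier_a \<phi> k * cos (real k * x) + fourier_b \<phi> k * sin (real k * x) =
        1 / \<psi> k * (fourier_a f k * cos (real k * x + \<beta> * pi / 2) +
                    fourier_b f k * sin (real k * x + \<beta> * pi / 2)))"

definition L_class :: "(nat \<Rightarrow> real) \<Rightarrow> real \<Rightarrow> (real \<Rightarrow> real) set \<Rightarrow> (real \<Rightarrow> real) set" where
  "L_class \<psi> \<beta> \<NN> = {f \<in> L_space 1. \<exists>\<phi>\<in>\<NN>. is_psi_beta_derivative \<psi> \<beta> f \<phi>}"

definition C_class :: "(nat \<Rightarrow> real) \<Rightarrow> real \<Rightarrow> (real \<Rightarrow> real) set \<Rightarrow> (real \<Rightarrow> real) set" where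
  "C_class \<psi> \<beta> \<NN> = C_space \<inter> L_class \<psi> \<beta> \<NN>"

definition D_set :: "real \<Rightarrow> (nat \<Rightarrow> real) set" where
  "D_set q = {\<psi>. (\<forall>k\<ge>1. \<psi> k > 0) \<and> (\<lambda>k. \<psi> (k + 1) / \<psi> k) \<longlonglongrightarrow> q}"

definition U0 :: "ereal \<Rightarrow> (real \<Rightarrow> real) set" where
  "U0 s = {\<phi> \<in> L_space s. L_norm s \<phi> \<le> 1 \<and> (\<integral>t. \<phi> t \<partial>lebesgue_on {0..2 * pi}) = 0}"

definition is_modulus_of_continuity :: "(real \<Rightarrow> real) \<Rightarrow> bool" where
  "is_modulus_of_continuity \<omega> \<longleftrightarrow>
     continuous_on {0..} \<omega> \<and> mono_on {0..} \<omega> \<and>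
     (\<forall>s\<ge>0. \<forall>t\<ge>0. \<omega> (s + t) \<le> \<omega> s + \<omega> t) \<and> \<omega> 0 = 0"

definition modulus_of :: "(real \<Rightarrow> real) \<Rightarrow> real \<Rightarrow> real" where
  "modulus_of \<phi> t = (SUP h\<in>{h. \<bar>h\<bar> \<le> t}. C_norm (\<lambda>x. \<phi> (x + h) - \<phi> x))"

definition H_class :: "(real \<Rightarrow> real) \<Rightarrow> (real \<Rightarrow> real) set" where
  "H_class \<omega> = {\<phi> \<in> C_space. \<forall>t\<ge>0. modulus_of \<phi> t \<le> \<omega> t}"

definition fourier_partial_sum :: "nat \<Rightarrow> (real \<Rightarrow> real) \<Rightarrow> real \<Rightarrow> real" where
  "fourier_partial_sum k f x =
     fourier_a f 0 / 2 +
     (\<Sum>j=1..k. fourier_a f j * cos (real j * x) + fourier_b f j * sin (real j * x))"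

definition vallee_poussin_sum :: "nat \<Rightarrow> nat \<Rightarrow> (real \<Rightarrow> real) \<Rightarrow> real \<Rightarrow> real" where
  "vallee_poussin_sum n p f x = (1 / real p) * (\<Sum>k\<in>{n - p..<n}. fourier_partial_sum k f x)"

definition class_error :: "(real \<Rightarrow> real) set \<Rightarrow> nat \<Rightarrow> nat \<Rightarrow> real" where
  "class_error \<MM> n p = (SUP f\<in>\<MM>. C_norm (\<lambda>x. f x - vallee_poussin_sum n p f x))"

definition ratio_dev :: "(nat \<Rightarrow> real) \<Rightarrow> real \<Rightarrow> nat \<Rightarrow> real" where
  "ratio_dev \<psi> q m = (SUP k\<in>{m..}. \<bar>\<psi> (k + 1) / \<psi> k - q\<bar>)"

end

theory Submission imports Defs begin

text \<open>
  The deviation \<open>f - V_{n,p}(f)\<close> only sees harmonics of order \<open>k \<ge> m := n - p + 1\<close>, the \<open>k\<close>-th one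
  with a weight at most \<open>min(p, k - m + 1) / p\<close>, and this harmonic is \<open>\<psi>(k)\<close> times a harmonic that
  depends only on \<open>\<phi> = f^\<psi>_\<beta>\<close>. Since every admissible \<open>\<phi>\<close> is the derivative of a continuous function
  both for \<open>\<psi>\<close> and for \<open>q^k\<close>, the two class errors are suprema over the same set of \<open>\<phi>\<close> and can be
  compared term by term. The ratios \<open>\<psi>(k+1)/\<psi>(k)\<close> differ from \<open>q\<close> by at most \<open>\<epsilon>\<close> for \<open>k \<ge> m\<close>, so
  \<open>|\<psi>(m+i)/\<psi>(m) - q^i| \<le> \<epsilon> i r^(i-1)\<close> with \<open>r = (1+q)/2\<close> as soon as \<open>\<epsilon> \<le> (1-q)/2\<close>, and summing
  these bounds against the weights yields \<open>16 \<epsilon> min(p, 1/(1-q)) / (1-q)^2\<close>. What remains is a bound for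
  a single harmonic of \<open>\<phi>\<close>: its \<open>L_1\<close> norm in the case of \<open>U_s^0\<close>, and \<open>\<omega>(\<pi>/k) \<le> 4 \<omega>(1/m)\<close> in the case
  of \<open>H_\<omega>\<close>.
\<close>

subsection \<open>Continuous periodic functions and uniqueness of Fourier coefficients\<close>

lemma periodic_2pi_int:
  assumes "periodic_2pi f"
  shows "f (x + 2 * pi * of_int n) = f x"
proof -
  have nat: "f (x + 2 * pi * real k) = f x" for x k
  proof (induction k)
    case (Suc k)
    have "f (x + 2 * pi * real (Suc k)) = f (x + 2 * pi * real k + 2 * pi)"
      by (simp add: algebra_simps)
    then show ?case using assms Suc by (simp add: periodic_2pi_def)
  qed simp
  show ?thesis
  proof (cases "n \<ge> 0")
    case True
    then show ?thesis using nat[of x "nat n"] by simp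
  next
    case False
    then show ?thesis using nat[of "x + 2 * pi * of_int n" "nat (- n)"] by simp
  qed
qed

lemma periodic_2pi_cis_eq:
  assumes "periodic_2pi f" "cis x = cis y"
  shows "f x = f y"
proof -
  have "sin x = sin y \<and> cos x = cos y"
    using assms(2) by (simp add: complex_eq_iff)
  then obtain n where "x = y + 2 * pi * of_int n"
    unfolding sin_cos_eq_iff by blast
  then show ?thesis using periodic_2pi_int[OF assms(1)] by simp
qed

lemma periodic_2pi_shift_into_period:
  assumes "periodic_2pi f"
  obtains y where "y \<in> {0..2 * pi}" "f x = f y"
proof
  show "Arg2pi (cis x) \<in> {0..2 * pi}"
    using Arg2pi[of "cis x"] by auto
  show "f x = f (Arg2pi (cis x))"
    by (rule periodic_2pi_cis_eq[OF assms]) (metis cis_conv_exp complex_norm_eq_1_exp norm_cis)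
qed

lemma C_space_continuous_on: "f \<in> C_space \<Longrightarrow> continuous_on S f"
  by (auto simp: C_space_def intro: continuous_on_subset)

lemma C_space_periodic: "f \<in> C_space \<Longrightarrow> periodic_2pi f"
  by (simp add: C_space_def)

lemma C_space_bounded:
  assumes "f \<in> C_space"
  obtains B where "\<And>x. \<bar>f x\<bar> \<le> B"
proof -
  have "compact (f ` {0..2 * pi})"
    using C_space_continuous_on[OF assms] by (intro compact_continuous_image) auto
  then obtain B where B: "\<forall>y\<in>f ` {0..2 * pi}. norm y \<le> B"
    using compact_imp_bounded bounded_iff by metis
  show ?thesis
  proof
    fix x
    obtain y where "y \<in> {0..2 * pi}" "f x = f y"
      using periodic_2pi_shift_into_period[OF C_space_periodic[OF assms]] .
    then show "\<bar>f x\<bar> \<le> B" using B by auto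
  qed
qed

lemma integral_lebesgue_on_continuous:
  fixes f :: "real \<Rightarrow> real"
  assumes "continuous_on {a..b} f"
  shows "(\<integral>t. f t \<partial>lebesgue_on {a..b}) = integral {a..b} f"
  using assms by (intro lebesgue_integral_eq_integral continuous_imp_integrable_real) auto

lemma fourier_a_C_space:
  assumes "f \<in> C_space"
  shows "fourier_a f k = (1 / pi) * integral {0..2 * pi} (\<lambda>t. f t * cos (real k * t))"
  unfolding fourier_a_def
  by (subst integral_lebesgue_on_continuous)
     (auto intro!: continuous_intros C_space_continuous_on[OF assms])

lemma fourier_b_C_space:
  assumes "f \<in> C_space"
  shows "fourier_b f k = (1 / pi) * integral {0..2 * pi} (\<lambda>t. f t * sin (real k * t))"
  unfolding fourier_b_def
  by (subst integral_lebesgue_on_continuous)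
     (auto intro!: continuous_intros C_space_continuous_on[OF assms])

text \<open>Stone-Weierstrass will be applied on the unit circle, so \<open>f\<close> has to become
  a continuous function there. The branch \<open>Arg2pi\<close> jumps at the nonnegative reals; at
  those points \<open>Arg\<close>, which jumps only at nonpositive reals, is used instead, and by
  periodicity both branches give the same \<open>F\<close>.\<close>

lemma C_space_factors_through_circle:
  assumes "f \<in> C_space"
  obtains F :: "complex \<Rightarrow> real"
  where "continuous_on (sphere 0 1) F" "\<And>x. F (cis x) = f x"
proof -
  note per = C_space_periodic[OF assms]
  define F where "F z = f (Arg2pi z)" for z
  have isC: "isCont f x" for x
    using assms by (auto simp: C_space_def continuous_on_eq_continuous_at)
  have F2: "F z = f (Arg z)" if "z \<noteq> 0" for z
    unfolding F_def
  proof (rule periodic_2pi_cis_eq[OF per])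
    show "cis (Arg2pi z) = cis (Arg z)"
      unfolding cis_conv_exp
      by (metis Arg2pi_eq Arg_eq that mult_left_cancel norm_eq_zero of_real_eq_0_iff)
  qed
  have "isCont F z" if "z \<in> sphere 0 1" for z
  proof (cases "z \<in> \<real>\<^sub>\<ge>\<^sub>0")
    case False
    have "isCont (\<lambda>z. f (Arg2pi z)) z"
      by (rule isCont_o2[OF continuous_at_Arg2pi[OF False] isC])
    then show ?thesis by (simp add: F_def[abs_def])
  next
    case True
    have nz: "z \<noteq> 0" using that by auto
    then have "z \<notin> \<real>\<^sub>\<le>\<^sub>0" using True
      by (auto simp: complex_nonneg_Reals_iff complex_nonpos_Reals_iff complex_eq_iff)
    then have c: "isCont (\<lambda>z. f (Arg z)) z"
      by (intro isCont_o2[OF continuous_at_Arg isC])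
    have ev: "eventually (\<lambda>y. F y = f (Arg y)) (nhds z)"
      using t1_space_nhds[OF nz] by eventually_elim (rule F2)
    show ?thesis using isCont_cong[OF ev] c by simp
  qed
  then have "continuous_on (sphere 0 1) F"
    by (auto intro: continuous_at_imp_continuous_on)
  moreover have "F (cis x) = f x" for x
    unfolding F_def
    by (rule periodic_2pi_cis_eq[OF per]) (metis cis_conv_exp complex_norm_eq_1_exp norm_cis)
  ultimately show ?thesis using that by blast
qed

text \<open>Vanishing coefficients make \<open>f\<close> orthogonal to every polynomial in
  \<open>cos t\<close> and \<open>sin t\<close>. Such polynomials approximate \<open>f\<close>
  uniformly, so the integral of \<open>f^2\<close> is at most \<open>e\<close> times that of
  \<open>\<bar>f\<bar>\<close> for every \<open>e > 0\<close>, hence zero.\<close>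

lemma C_space_eq_0_if_fourier_0:
  assumes f: "f \<in> C_space" and a: "\<And>k. fourier_a f k = 0" and b: "\<And>k. fourier_b f k = 0"
  shows "f x = 0"
proof -
  let ?I = "integral {0..2 * pi}"
  note cf = C_space_continuous_on[OF f]
  note ci = integrable_continuous_real
  \<comment> \<open>\<open>f h\<close> is orthogonal to every harmonic; this is preserved when \<open>h\<close> is multiplied by \<open>cos\<close> or \<open>sin\<close>,
    hence by any polynomial on the unit circle.\<close>
  define T where "T h \<longleftrightarrow> continuous_on UNIV h \<and>
     (\<forall>k::int. ?I (\<lambda>t. f t * h t * cos (of_int k * t)) = 0 \<and>
               ?I (\<lambda>t. f t * h t * sin (of_int k * t)) = 0)" for h
  have T_cont: "continuous_on S h" if "T h" for h S
    using that unfolding T_def by (auto intro: continuous_on_subset)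
  have T_0: "?I (\<lambda>t. f t * h t * cos (of_int k * t)) = 0"
           "?I (\<lambda>t. f t * h t * sin (of_int k * t)) = 0" if "T h" for h k
    using that unfolding T_def by auto
  have T_lin: "T (\<lambda>t. c * h t + d * g t)" if "T h" "T g" for h g c d
    unfolding T_def
  proof (intro conjI allI)
    fix k :: int
    have "?I (\<lambda>t. f t * (c * h t + d * g t) * cos (of_int k * t)) =
      ?I (\<lambda>t. c * (f t * h t * cos (of_int k * t)) + d * (f t * g t * cos (of_int k * t)))"
      by (simp add: algebra_simps)
    also have "\<dots> = c * ?I (\<lambda>t. f t * h t * cos (of_int k * t)) +
                     d * ?I (\<lambda>t. f t * g t * cos (of_int k * t))"
      by (subst integral_add) (auto intro!: ci continuous_intros cf T_cont[OF that(1)] T_cont[OF that(2)])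
    also have "\<dots> = 0" using that by (simp add: T_def)
    finally show "?I (\<lambda>t. f t * (c * h t + d * g t) * cos (of_int k * t)) = 0" .
    have "?I (\<lambda>t. f t * (c * h t + d * g t) * sin (of_int k * t)) =
      ?I (\<lambda>t. c * (f t * h t * sin (of_int k * t)) + d * (f t * g t * sin (of_int k * t)))"
      by (simp add: algebra_simps)
    also have "\<dots> = c * ?I (\<lambda>t. f t * h t * sin (of_int k * t)) +
                     d * ?I (\<lambda>t. f t * g t * sin (of_int k * t))"
      by (subst integral_add) (auto intro!: ci continuous_intros cf T_cont[OF that(1)] T_cont[OF that(2)])
    also have "\<dots> = 0" using that by (simp add: T_def)
    finally show "?I (\<lambda>t. f t * (c * h t + d * g t) * sin (of_int k * t)) = 0" .
  qed (auto intro!: continuous_intros T_cont[OF that(1)] T_cont[OF that(2)])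
  \<comment> \<open>The product formulas shift the frequency by one in both directions; letting
    \<open>k\<close> range over the integers keeps \<open>k - 1\<close> admissible at
    \<open>k = 0\<close>.\<close>
  have T_cos: "T (\<lambda>t. cos t * h t)" if "T h" for h
    unfolding T_def
  proof (intro conjI allI)
    fix k :: int
    have "?I (\<lambda>t. f t * (cos t * h t) * cos (of_int k * t)) =
      ?I (\<lambda>t. (1/2) * (f t * h t * cos (of_int (k + 1) * t)) + (1/2) * (f t * h t * cos (of_int (k - 1) * t)))"
      by (rule arg_cong[where f = ?I]) (auto simp: algebra_simps cos_add cos_diff)
    also have "\<dots> = (1/2) * ?I (\<lambda>t. f t * h t * cos (of_int (k + 1) * t)) +
                     (1/2) * ?I (\<lambda>t. f t * h t * cos (of_int (k - 1) * t))"
      by (subst integral_add) (auto intro!: ci continuous_intros cf T_cont[OF that])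
    also have "\<dots> = 0" by (simp only: T_0[OF that] mult_zero_right add_0_left)
    finally show "?I (\<lambda>t. f t * (cos t * h t) * cos (of_int k * t)) = 0" .
    have "?I (\<lambda>t. f t * (cos t * h t) * sin (of_int k * t)) =
      ?I (\<lambda>t. (1/2) * (f t * h t * sin (of_int (k + 1) * t)) + (1/2) * (f t * h t * sin (of_int (k - 1) * t)))"
      by (rule arg_cong[where f = ?I]) (auto simp: algebra_simps sin_add sin_diff)
    also have "\<dots> = (1/2) * ?I (\<lambda>t. f t * h t * sin (of_int (k + 1) * t)) +
                     (1/2) * ?I (\<lambda>t. f t * h t * sin (of_int (k - 1) * t))"
      by (subst integral_add) (auto intro!: ci continuous_intros cf T_cont[OF that])
    also have "\<dots> = 0" by (simp only: T_0[OF that] mult_zero_right add_0_left)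
    finally show "?I (\<lambda>t. f t * (cos t * h t) * sin (of_int k * t)) = 0" .
  qed (auto intro!: continuous_intros T_cont[OF that])
  have T_sin: "T (\<lambda>t. sin t * h t)" if "T h" for h
    unfolding T_def
  proof (intro conjI allI)
    fix k :: int
    have "?I (\<lambda>t. f t * (sin t * h t) * cos (of_int k * t)) =
      ?I (\<lambda>t. (1/2) * (f t * h t * sin (of_int (k + 1) * t)) + (-1/2) * (f t * h t * sin (of_int (k - 1) * t)))"
      by (rule arg_cong[where f = ?I]) (auto simp: algebra_simps sin_add sin_diff)
    also have "\<dots> = (1/2) * ?I (\<lambda>t. f t * h t * sin (of_int (k + 1) * t)) +
                     (-1/2) * ?I (\<lambda>t. f t * h t * sin (of_int (k - 1) * t))"
      by (subst integral_add) (auto intro!: ci continuous_intros cf T_cont[OF that])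
    also have "\<dots> = 0" by (simp only: T_0[OF that] mult_zero_right add_0_left)
    finally show "?I (\<lambda>t. f t * (sin t * h t) * cos (of_int k * t)) = 0" .
    have "?I (\<lambda>t. f t * (sin t * h t) * sin (of_int k * t)) =
      ?I (\<lambda>t. (1/2) * (f t * h t * cos (of_int (k - 1) * t)) + (-1/2) * (f t * h t * cos (of_int (k + 1) * t)))"
      by (rule arg_cong[where f = ?I]) (auto simp: algebra_simps cos_add cos_diff)
    also have "\<dots> = (1/2) * ?I (\<lambda>t. f t * h t * cos (of_int (k - 1) * t)) +
                     (-1/2) * ?I (\<lambda>t. f t * h t * cos (of_int (k + 1) * t))"
      by (subst integral_add) (auto intro!: ci continuous_intros cf T_cont[OF that])
    also have "\<dots> = 0" by (simp only: T_0[OF that] mult_zero_right add_0_left)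
    finally show "?I (\<lambda>t. f t * (sin t * h t) * sin (of_int k * t)) = 0" .
  qed (auto intro!: continuous_intros T_cont[OF that])
  \<comment> \<open>With \<open>h\<close> arbitrary, the product case applies the two induction
    hypotheses one after the other. A linear form is determined by its values at \<open>1\<close>
    and \<open>\<i>\<close>, which reduces it to \<open>T_cos\<close> and
    \<open>T_sin\<close>.\<close>
  have T_poly: "T (\<lambda>t. g (cis t) * h t)" if "real_polynomial_function g" "T h" for g h
    using that
  proof (induction arbitrary: h)
    case (linear g)
    interpret bounded_linear g by fact
    have "g (cis t) = Re (cis t) * g 1 + Im (cis t) * g \<i>" for t
    proof -
      have "g (Re (cis t) *\<^sub>R 1 + Im (cis t) *\<^sub>R \<i>) = Re (cis t) * g 1 + Im (cis t) * g \<i>"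
        by (simp only: add scaleR real_scaleR_def)
      moreover have "Re (cis t) *\<^sub>R 1 + Im (cis t) *\<^sub>R \<i> = cis t"
        by (simp add: complex_eq_iff)
      ultimately show ?thesis by simp
    qed
    then have "(\<lambda>t. g (cis t) * h t) = (\<lambda>t. g 1 * (cos t * h t) + g \<i> * (sin t * h t))"
      by (auto simp: algebra_simps)
    then show ?case using T_lin[OF T_cos[OF linear.prems] T_sin[OF linear.prems], of "g 1" "g \<i>"] by simp
  next
    case (const c)
    then show ?case using T_lin[of h h c 0] by simp
  next
    case (add g1 g2)
    have "T (\<lambda>t. 1 * (g1 (cis t) * h t) + 1 * (g2 (cis t) * h t))"
      by (intro T_lin add.IH add.prems)
    then show ?case by (simp add: algebra_simps)
  next
    case (mult g1 g2)
    have "T (\<lambda>t. g1 (cis t) * (g2 (cis t) * h t))"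
      by (intro mult.IH mult.prems)
    then show ?case by (simp add: algebra_simps)
  qed
  have zc: "?I (\<lambda>t. f t * cos (real k * t)) = 0" and zs: "?I (\<lambda>t. f t * sin (real k * t)) = 0" for k
    using a[of k] b[of k] by (simp_all add: fourier_a_C_space[OF f] fourier_b_C_space[OF f])
  have T1: "T (\<lambda>t. 1)"
    unfolding T_def
  proof (intro conjI allI)
    fix k :: int
    have "(\<lambda>t. f t * 1 * cos (of_int k * t)) = (\<lambda>t. f t * cos (real (nat \<bar>k\<bar>) * t))"
      by (cases "k \<ge> 0") auto
    then show "?I (\<lambda>t. f t * 1 * cos (of_int k * t)) = 0" by (simp only: zc)
    show "?I (\<lambda>t. f t * 1 * sin (of_int k * t)) = 0"
    proof (cases "k \<ge> 0")
      case True
      then show ?thesis using zs[of "nat k"] by simp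
    next
      case False
      then show ?thesis using zs[of "nat (-k)"] by simp
    qed
  qed simp
  obtain F where F: "continuous_on (sphere 0 1) F" "\<And>x. F (cis x) = f x"
    using C_space_factors_through_circle[OF f] by blast
  have small: "?I (\<lambda>t. f t * f t) \<le> e * ?I (\<lambda>t. \<bar>f t\<bar>)" if "e > 0" for e
  proof -
    obtain g where g: "real_polynomial_function g"
        "\<And>z. z \<in> sphere 0 1 \<Longrightarrow> \<bar>F z - g z\<bar> < e"
      using Stone_Weierstrass_real_polynomial_function[OF _ F(1) \<open>e > 0\<close>] by auto
    have Tg: "T (\<lambda>t. g (cis t))" using T_poly[OF g(1) T1] by simp
    \<comment> \<open>This is the cosine condition of \<open>T\<close> at frequency
      \<open>0\<close>.\<close>
    have *: "?I (\<lambda>t. f t * g (cis t)) = 0"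
      using Tg unfolding T_def by (auto dest: spec[of _ 0])
    have "?I (\<lambda>t. f t * f t) = ?I (\<lambda>t. f t * f t) - ?I (\<lambda>t. f t * g (cis t))"
      using * by simp
    also have "\<dots> = ?I (\<lambda>t. f t * f t - f t * g (cis t))"
      by (rule integral_diff[symmetric]) (auto intro!: ci continuous_intros cf T_cont[OF Tg])
    also have "\<dots> \<le> ?I (\<lambda>t. e * \<bar>f t\<bar>)"
    proof (rule integral_le)
      fix t
      have "f t * f t - f t * g (cis t) = f t * (F (cis t) - g (cis t))"
        by (simp add: F algebra_simps)
      also have "\<dots> \<le> \<bar>f t\<bar> * \<bar>F (cis t) - g (cis t)\<bar>"
        by (metis abs_ge_self abs_mult)
      also have "\<dots> \<le> \<bar>f t\<bar> * e"
        using g(2)[of "cis t"] by (intro mult_left_mono) auto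
      finally show "f t * f t - f t * g (cis t) \<le> e * \<bar>f t\<bar>" by (simp add: mult.commute)
    qed (auto intro!: ci continuous_intros cf T_cont[OF Tg])
    finally show ?thesis by simp
  qed
  have "?I (\<lambda>t. f t * f t) \<le> 0 + e" if "e > 0" for e
  proof -
    have "?I (\<lambda>t. \<bar>f t\<bar>) \<ge> 0" by (intro integral_nonneg ci continuous_intros cf) auto
    \<comment> \<open>The summand \<open>1\<close> keeps the denominator positive even if the
      integral of \<open>\<bar>f\<bar>\<close> vanishes.\<close>
    then have "e / (1 + ?I (\<lambda>t. \<bar>f t\<bar>)) * ?I (\<lambda>t. \<bar>f t\<bar>) \<le> e"
      using that by (simp add: field_simps)
    moreover have "e / (1 + ?I (\<lambda>t. \<bar>f t\<bar>)) > 0"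
      using that \<open>?I (\<lambda>t. \<bar>f t\<bar>) \<ge> 0\<close> by simp
    ultimately show ?thesis using small by fastforce
  qed
  then have "?I (\<lambda>t. f t * f t) \<le> 0" by (rule field_le_epsilon)
  moreover have "?I (\<lambda>t. f t * f t) \<ge> 0"
    by (intro integral_nonneg ci continuous_intros cf) auto
  ultimately have "?I (\<lambda>t. f t * f t) = 0" by simp
  then have z: "\<forall>t\<in>{0..2 * pi}. f t * f t = 0"
    by (subst (asm) integral_eq_0_iff) (auto intro!: continuous_intros cf)
  obtain y where "y \<in> {0..2 * pi}" "f x = f y"
    using periodic_2pi_shift_into_period[OF C_space_periodic[OF f]] .
  then show ?thesis using z by auto
qed

subsection \<open>Absolutely convergent trigonometric series\<close>

lemma integral_cos_of_int:
  "integral {0..2 * pi} (\<lambda>t. cos (of_int n * t)) = (if n = 0 then 2 * pi else 0)"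
proof (cases "n = 0")
  case False
  have "((\<lambda>t. cos (of_int n * t)) has_integral
      sin (of_int n * (2 * pi)) / of_int n - sin (of_int n * 0) / of_int n) {0..2 * pi}"
  proof (rule fundamental_theorem_of_calculus)
    fix x
    have "((\<lambda>t. sin (of_int n * t) / of_int n) has_real_derivative cos (of_int n * x)) (at x within {0..2 * pi})"
      using False by (auto intro!: derivative_eq_intros)
    then show "((\<lambda>t. sin (of_int n * t) / of_int n) has_vector_derivative cos (of_int n * x)) (at x within {0..2 * pi})"
      by (simp add: has_real_derivative_iff_has_vector_derivative)
  qed simp
  moreover have "sin (of_int n * (2 * pi)) = 0"
    by (metis mult.commute sin_int_2pin)
  ultimately show ?thesis using False by (simp add: integral_unique)
qed simp

lemma integral_sin_of_int: "integral {0..2 * pi} (\<lambda>t. sin (of_int n * t)) = 0"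
proof (cases "n = 0")
  case False
  have "((\<lambda>t. sin (of_int n * t)) has_integral
      - cos (of_int n * (2 * pi)) / of_int n - - cos (of_int n * 0) / of_int n) {0..2 * pi}"
  proof (rule fundamental_theorem_of_calculus)
    fix x
    have "((\<lambda>t. - cos (of_int n * t) / of_int n) has_real_derivative sin (of_int n * x)) (at x within {0..2 * pi})"
      using False by (auto intro!: derivative_eq_intros)
    then show "((\<lambda>t. - cos (of_int n * t) / of_int n) has_vector_derivative sin (of_int n * x)) (at x within {0..2 * pi})"
      by (simp add: has_real_derivative_iff_has_vector_derivative)
  qed simp
  moreover have "cos (of_int n * (2 * pi)) = 1"
    by (metis mult.commute cos_int_2pin)
  ultimately show ?thesis using False by (simp add: integral_unique)
qed simp

text \<open>Product-to-sum formulas leave the integer frequencies \<open>j - k\<close> and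
  \<open>j + k\<close>. Both vanish when \<open>j = k = 0\<close>, which explains the doubled value
  there.\<close>

lemma integral_harmonic_cos:
  "integral {0..2 * pi} (\<lambda>t. (c * cos (real j * t) + d * sin (real j * t)) * cos (real k * t)) =
     (if j = k then if k = 0 then 2 * pi * c else pi * c else 0)"
proof -
  let ?J = "int j" and ?K = "int k"
  let ?c = "\<lambda>n::int. \<lambda>t. cos (of_int n * t)" and ?s = "\<lambda>n::int. \<lambda>t. sin (of_int n * t)"
  note ci = integrable_continuous_real
  have e: "?J - ?K = 0 \<longleftrightarrow> j = k" "?J + ?K = 0 \<longleftrightarrow> j = 0 \<and> k = 0" by auto
  have "integral {0..2 * pi} (\<lambda>t. (c * cos (real j * t) + d * sin (real j * t)) * cos (real k * t)) =
    integral {0..2 * pi} (\<lambda>t. c / 2 * ?c (?J - ?K) t + (c / 2 * ?c (?J + ?K) t + (d / 2 * ?s (?J - ?K) t + d / 2 * ?s (?J + ?K) t)))"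
    by (rule arg_cong[where f = "integral _"])
       (auto simp: algebra_simps cos_add cos_diff sin_add sin_diff)
  also have "\<dots> = c / 2 * integral {0..2 * pi} (?c (?J - ?K)) + (c / 2 * integral {0..2 * pi} (?c (?J + ?K))
     + (d / 2 * integral {0..2 * pi} (?s (?J - ?K)) + d / 2 * integral {0..2 * pi} (?s (?J + ?K))))"
    by (subst integral_add, (auto intro!: ci continuous_intros)[2])+ (simp only: integral_mult_right)
  also have "\<dots> = (if j = k then if k = 0 then 2 * pi * c else pi * c else 0)"
    unfolding integral_cos_of_int integral_sin_of_int e by (cases "j = k"; cases "k = 0") simp_all
  finally show ?thesis .
qed

lemma integral_harmonic_sin:
  "integral {0..2 * pi} (\<lambda>t. (c * cos (real j * t) + d * sin (real j * t)) * sin (real k * t)) =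
     (if j = k \<and> k \<noteq> 0 then pi * d else 0)"
proof -
  let ?J = "int j" and ?K = "int k"
  let ?c = "\<lambda>n::int. \<lambda>t. cos (of_int n * t)" and ?s = "\<lambda>n::int. \<lambda>t. sin (of_int n * t)"
  note ci = integrable_continuous_real
  have e: "?J - ?K = 0 \<longleftrightarrow> j = k" "?J + ?K = 0 \<longleftrightarrow> j = 0 \<and> k = 0" by auto
  have "integral {0..2 * pi} (\<lambda>t. (c * cos (real j * t) + d * sin (real j * t)) * sin (real k * t)) =
    integral {0..2 * pi} (\<lambda>t. - c / 2 * ?s (?J - ?K) t + (c / 2 * ?s (?J + ?K) t + (d / 2 * ?c (?J - ?K) t + - d / 2 * ?c (?J + ?K) t)))"
    by (rule arg_cong[where f = "integral _"])
       (auto simp: algebra_simps cos_add cos_diff sin_add sin_diff)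
  also have "\<dots> = - c / 2 * integral {0..2 * pi} (?s (?J - ?K)) + (c / 2 * integral {0..2 * pi} (?s (?J + ?K))
     + (d / 2 * integral {0..2 * pi} (?c (?J - ?K)) + - d / 2 * integral {0..2 * pi} (?c (?J + ?K))))"
    by (subst integral_add, (auto intro!: ci continuous_intros)[2])+ (simp only: integral_mult_right)
  also have "\<dots> = (if j = k \<and> k \<noteq> 0 then pi * d else 0)"
    unfolding integral_cos_of_int integral_sin_of_int e by (cases "j = k"; cases "k = 0") simp_all
  finally show ?thesis .
qed

text \<open>The Weierstrass M-test gives uniform convergence, which permits termwise
  integration.\<close>

lemma sums_integral_dominated_series:
  fixes u :: "nat \<Rightarrow> real \<Rightarrow> real"
  assumes "\<And>n x. x \<in> {a..b} \<Longrightarrow> \<bar>u n x\<bar> \<le> M n" "summable M"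
    and "\<And>n. continuous_on {a..b} (u n)"
  shows "(\<lambda>n. integral {a..b} (u n)) sums integral {a..b} (\<lambda>x. \<Sum>n. u n x)"
proof -
  have "uniform_limit {a..b} (\<lambda>n x. \<Sum>i<n. u i x) (\<lambda>x. \<Sum>i. u i x) sequentially"
    using assms by (intro Weierstrass_m_test) auto
  then obtain I J where IJ: "\<And>n. ((\<lambda>x. \<Sum>i<n. u i x) has_integral I n) {a..b}"
     "((\<lambda>x. \<Sum>i. u i x) has_integral J) {a..b}" "I \<longlonglongrightarrow> J"
    by (rule uniform_limit_integral) (auto intro!: continuous_intros assms)
  have "I n = (\<Sum>i<n. integral {a..b} (u i))" for n
    by (subst integral_sum[symmetric])
       (auto intro!: integrable_continuous_real assms integral_unique[OF IJ(1), symmetric])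
  then have "I = (\<lambda>n. \<Sum>i<n. integral {a..b} (u i))" by (rule ext)
  then show ?thesis
    using IJ(3) unfolding sums_def integral_unique[OF IJ(2)] by simp
qed

lemma abs_harmonic_le: "\<bar>(c::real) * cos x + d * sin x\<bar> \<le> \<bar>c\<bar> + \<bar>d\<bar>"
proof -
  have "\<bar>c * cos x + d * sin x\<bar> \<le> \<bar>c\<bar> * \<bar>cos x\<bar> + \<bar>d\<bar> * \<bar>sin x\<bar>"
    by (metis abs_mult abs_triangle_ineq)
  also have "\<dots> \<le> \<bar>c\<bar> * 1 + \<bar>d\<bar> * 1"
    by (intro add_mono mult_left_mono) auto
  finally show ?thesis by simp
qed

text \<open>Termwise integration and orthogonality recover the coefficients. The series carries the
  full constant \<open>c 0\<close>, whence \<open>2 * c 0\<close> in \<open>fourier_a\<close>, and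
  \<open>d 0\<close> is lost because it multiplies \<open>sin 0\<close>.\<close>

lemma trig_series:
  fixes c d :: "nat \<Rightarrow> real"
  assumes "summable (\<lambda>j. \<bar>c j\<bar>)" "summable (\<lambda>j. \<bar>d j\<bar>)"
  defines "f \<equiv> \<lambda>x. \<Sum>j. c j * cos (real j * x) + d j * sin (real j * x)"
  shows trig_series_sums: "(\<lambda>j. c j * cos (real j * x) + d j * sin (real j * x)) sums f x"
    and trig_series_C_space: "f \<in> C_space"
    and trig_series_fourier_a: "fourier_a f k = (if k = 0 then 2 * c 0 else c k)"
    and trig_series_fourier_b: "fourier_b f k = (if k = 0 then 0 else d k)"
proof -
  let ?h = "\<lambda>j x. c j * cos (real j * x) + d j * sin (real j * x)"
  have sum: "summable (\<lambda>j. \<bar>c j\<bar> + \<bar>d j\<bar>)"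
    using assms by (intro summable_add)
  have summ: "summable (\<lambda>j. ?h j x)" for x
    by (rule summable_comparison_test'[OF sum, of 0]) (simp add: abs_harmonic_le)
  then show "(\<lambda>j. ?h j x) sums f x"
    unfolding f_def by (rule summable_sums)
  have "uniform_limit UNIV (\<lambda>n x. \<Sum>i<n. ?h i x) f sequentially"
    unfolding f_def by (rule Weierstrass_m_test[OF _ sum]) (simp add: abs_harmonic_le)
  then have "continuous_on UNIV f"
    by (rule uniform_limit_theorem[rotated]) (auto intro!: always_eventually continuous_intros)
  moreover have "?h j (x + 2 * pi) = ?h j x" for j x
  proof -
    have "real j * (x + 2 * pi) = real j * x + 2 * real j * pi" by (simp add: algebra_simps)
    then show ?thesis by (simp only: cos_add sin_add cos_2npi sin_2npi) simp
  qed
  then have "periodic_2pi f" by (simp add: periodic_2pi_def f_def)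
  ultimately show fC: "f \<in> C_space" by (simp add: C_space_def)
  have bd: "\<bar>?h j x * y\<bar> \<le> \<bar>c j\<bar> + \<bar>d j\<bar>" if "\<bar>y\<bar> \<le> 1" for j x y
    using mult_mono[OF abs_harmonic_le that, of "c j" "d j" "real j * x"] by (simp add: abs_mult)
  have "(\<lambda>j. integral {0..2 * pi} (\<lambda>t. ?h j t * cos (real k * t)))
      sums integral {0..2 * pi} (\<lambda>t. \<Sum>j. ?h j t * cos (real k * t))"
    by (rule sums_integral_dominated_series[OF bd sum]) (auto intro!: continuous_intros)
  also have "(\<lambda>t. \<Sum>j. ?h j t * cos (real k * t)) = (\<lambda>t. f t * cos (real k * t))"
    unfolding f_def by (rule ext) (rule suminf_mult2[OF summ, symmetric])
  finally have "(\<lambda>j. if j = k then if k = 0 then 2 * pi * c j else pi * c j else 0)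
      sums integral {0..2 * pi} (\<lambda>t. f t * cos (real k * t))"
    unfolding integral_harmonic_cos .
  from sums_unique2[OF this sums_single]
  show "fourier_a f k = (if k = 0 then 2 * c 0 else c k)"
    by (simp add: fourier_a_C_space[OF fC])
  have "(\<lambda>j. integral {0..2 * pi} (\<lambda>t. ?h j t * sin (real k * t)))
      sums integral {0..2 * pi} (\<lambda>t. \<Sum>j. ?h j t * sin (real k * t))"
    by (rule sums_integral_dominated_series[OF bd sum]) (auto intro!: continuous_intros)
  also have "(\<lambda>t. \<Sum>j. ?h j t * sin (real k * t)) = (\<lambda>t. f t * sin (real k * t))"
    unfolding f_def by (rule ext) (rule suminf_mult2[OF summ, symmetric])
  finally have "(\<lambda>j. if j = k \<and> k \<noteq> 0 then pi * d j else 0)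
      sums integral {0..2 * pi} (\<lambda>t. f t * sin (real k * t))"
    unfolding integral_harmonic_sin .
  then have "(\<lambda>j. if j = k then (if k \<noteq> 0 then pi * d j else 0) else 0)
      sums integral {0..2 * pi} (\<lambda>t. f t * sin (real k * t))"
    by (rule back_subst[where P = "\<lambda>u. u sums _"]) auto
  from sums_unique2[OF this sums_single]
  show "fourier_b f k = (if k = 0 then 0 else d k)"
    by (simp add: fourier_b_C_space[OF fC])
qed

lemma C_space_diff: "f \<in> C_space \<Longrightarrow> g \<in> C_space \<Longrightarrow> (\<lambda>x. f x - g x) \<in> C_space"
  by (auto simp: C_space_def periodic_2pi_def intro: continuous_intros)

lemma fourier_diff:
  assumes f: "f \<in> C_space" and g: "g \<in> C_space"
  shows "fourier_a (\<lambda>x. f x - g x) k = fourier_a f k - fourier_a g k"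
    and "fourier_b (\<lambda>x. f x - g x) k = fourier_b f k - fourier_b g k"
proof -
  have I: "integral {0..2 * pi} (\<lambda>t. (f t - g t) * h t) =
      integral {0..2 * pi} (\<lambda>t. f t * h t) - integral {0..2 * pi} (\<lambda>t. g t * h t)"
    if "continuous_on {0..2 * pi} h" for h
    unfolding left_diff_distrib
    by (intro integral_diff integrable_continuous_real continuous_intros that
        C_space_continuous_on[OF f] C_space_continuous_on[OF g])
  show "fourier_a (\<lambda>x. f x - g x) k = fourier_a f k - fourier_a g k"
    unfolding fourier_a_C_space[OF C_space_diff[OF f g]] fourier_a_C_space[OF f] fourier_a_C_space[OF g]
    by (subst I) (auto intro!: continuous_intros simp: right_diff_distrib)
  show "fourier_b (\<lambda>x. f x - g x) k = fourier_b f k - fourier_b g k"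
    unfolding fourier_b_C_space[OF C_space_diff[OF f g]] fourier_b_C_space[OF f] fourier_b_C_space[OF g]
    by (subst I) (auto intro!: continuous_intros simp: right_diff_distrib)
qed

lemma fourier_b_0: "fourier_b f 0 = 0"
  by (simp add: fourier_b_def)

text \<open>The series converges to a continuous function with the same Fourier coefficients as
  \<open>f\<close>; the two agree everywhere by uniqueness.\<close>

lemma C_space_fourier_series_sums:
  assumes f: "f \<in> C_space"
    and "summable (\<lambda>j. \<bar>fourier_a f j\<bar>)" "summable (\<lambda>j. \<bar>fourier_b f j\<bar>)"
  shows "(\<lambda>j. (if j = 0 then fourier_a f 0 / 2 else fourier_a f j) * cos (real j * x)
            + fourier_b f j * sin (real j * x)) sums f x"
proof -
  define c where "c j = (if j = 0 then fourier_a f 0 / 2 else fourier_a f j)" for j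
  have c: "summable (\<lambda>j. \<bar>c j\<bar>)"
    by (rule summable_comparison_test'[OF assms(2), of 0]) (simp add: c_def)
  let ?g = "\<lambda>x. \<Sum>j. c j * cos (real j * x) + fourier_b f j * sin (real j * x)"
  note g = trig_series[OF c assms(3)]
  have "fourier_a ?g k = fourier_a f k" for k
    by (simp only: g(3)) (simp add: c_def)
  moreover have "fourier_b ?g k = fourier_b f k" for k
    by (simp only: g(4)) (simp add: fourier_b_0)
  ultimately have "f x - ?g x = 0"
    by (intro C_space_eq_0_if_fourier_0[OF C_space_diff[OF f g(2)]])
       (simp_all only: fourier_diff[OF f g(2)] diff_self)
  then show ?thesis using g(1)[of x] by (simp add: c_def)
qed

subsection \<open>The deviation as a series over the harmonics of the derivative\<close>

text \<open>The \<open>k\<close>-th harmonic of the derivative with its phase turned back, so that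
  multiplication by \<open>\<psi> k\<close> yields the \<open>k\<close>-th harmonic of the original
  function.\<close>

definition rotated_harmonic :: "real \<Rightarrow> (real \<Rightarrow> real) \<Rightarrow> nat \<Rightarrow> real \<Rightarrow> real" where
  "rotated_harmonic \<beta> \<phi> k x =
     fourier_a \<phi> k * cos (real k * x - \<beta> * pi / 2) + fourier_b \<phi> k * sin (real k * x - \<beta> * pi / 2)"

lemma abs_rotated_harmonic_le: "\<bar>rotated_harmonic \<beta> \<phi> k x\<bar> \<le> \<bar>fourier_a \<phi> k\<bar> + \<bar>fourier_b \<phi> k\<bar>"
  unfolding rotated_harmonic_def by (rule abs_harmonic_le)

lemma psi_beta_derivative_harmonic:
  assumes "is_psi_beta_derivative \<psi> \<beta> f \<phi>" "k \<ge> 1" "\<psi> k \<noteq> 0"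
  shows "fourier_a f k * cos (real k * x) + fourier_b f k * sin (real k * x) =
           \<psi> k * rotated_harmonic \<beta> \<phi> k x"
proof -
  \<comment> \<open>The defining identity of the derivative holds at every point; evaluated here,
    its phase moves from \<open>f\<close> to \<open>\<phi>\<close>.\<close>
  define y where "y = x - \<beta> * pi / 2 / real k"
  have y: "real k * y = real k * x - \<beta> * pi / 2"
    using assms(2) by (simp add: y_def field_simps)
  have "fourier_a \<phi> k * cos (real k * y) + fourier_b \<phi> k * sin (real k * y) =
        1 / \<psi> k * (fourier_a f k * cos (real k * y + \<beta> * pi / 2) +
                    fourier_b f k * sin (real k * y + \<beta> * pi / 2))"
    using assms(1,2) unfolding is_psi_beta_derivative_def by blast
  then show ?thesis
    using assms(3) unfolding y rotated_harmonic_def by simp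
qed

section \<open>Boundedness of the Fourier coefficients of integrable functions\<close>

lemma L_space_1_integrable:
  assumes "\<phi> \<in> L_space 1"
  shows "integrable (lebesgue_on {0..2 * pi}) (\<lambda>t. \<bar>\<phi> t\<bar>)"
  using assms by (simp add: L_space_def)

lemma C_space_subset_L_space_1: "C_space \<subseteq> L_space 1"
proof
  fix f assume f: "f \<in> C_space"
  have "f \<in> borel_measurable lebesgue"
    using C_space_continuous_on[OF f, of UNIV]
    by (intro measurable_completion) (simp add: borel_measurable_continuous_onI)
  moreover have "integrable (lebesgue_on {0..2 * pi}) (\<lambda>t. \<bar>f t\<bar>)"
    by (intro continuous_imp_integrable_real continuous_intros C_space_continuous_on[OF f])
  ultimately show "f \<in> L_space 1"
    using C_space_periodic[OF f] by (simp add: L_space_def)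
qed

lemma abs_integral_mult_le:
  fixes g :: "real \<Rightarrow> real"
  assumes "\<phi> \<in> L_space 1" and g: "continuous_on UNIV g" "\<And>t. \<bar>g t\<bar> \<le> 1"
  shows "\<bar>\<integral>t. \<phi> t * g t \<partial>lebesgue_on {0..2 * pi}\<bar> \<le> (\<integral>t. \<bar>\<phi> t\<bar> \<partial>lebesgue_on {0..2 * pi})"
proof -
  let ?M = "lebesgue_on {0..2 * pi}"
  have le: "\<bar>\<phi> t * g t\<bar> \<le> \<bar>\<phi> t\<bar>" for t
    using mult_left_mono[OF g(2)[of t], of "\<bar>\<phi> t\<bar>"] by (simp add: abs_mult)
  have "g \<in> borel_measurable lebesgue"
    using g(1) by (intro measurable_completion) (simp add: borel_measurable_continuous_onI)
  then have "(\<lambda>t. \<phi> t * g t) \<in> borel_measurable lebesgue"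
    using assms(1) by (intro borel_measurable_times) (auto simp: L_space_def)
  then have "(\<lambda>t. \<phi> t * g t) \<in> borel_measurable ?M"
    by (rule measurable_restrict_space1)
  then have "integrable ?M (\<lambda>t. \<phi> t * g t)"
    by (rule Bochner_Integration.integrable_bound[OF L_space_1_integrable[OF assms(1)]])
       (simp add: le)
  then have "(\<integral>t. \<bar>\<phi> t * g t\<bar> \<partial>?M) \<le> (\<integral>t. \<bar>\<phi> t\<bar> \<partial>?M)"
    by (intro integral_mono integrable_abs L_space_1_integrable[OF assms(1)] le)
  then show ?thesis by (rule order_trans[OF integral_abs_bound])
qed

lemma abs_fourier_le:
  assumes "\<phi> \<in> L_space 1"
  shows "\<bar>fourier_a \<phi> k\<bar> \<le> (1 / pi) * (\<integral>t. \<bar>\<phi> t\<bar> \<partial>lebesgue_on {0..2 * pi})"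
    and "\<bar>fourier_b \<phi> k\<bar> \<le> (1 / pi) * (\<integral>t. \<bar>\<phi> t\<bar> \<partial>lebesgue_on {0..2 * pi})"
  unfolding fourier_a_def fourier_b_def abs_mult
  by (auto intro!: divide_right_mono abs_integral_mult_le assms continuous_intros)

text \<open>
  \<open>vp_weight n p j / p\<close> is one minus the multiplier of the \<open>j\<close>-th harmonic in \<open>V_{n,p}\<close>.
\<close>

definition vp_weight :: "nat \<Rightarrow> nat \<Rightarrow> nat \<Rightarrow> nat" where
  "vp_weight n p j = card {k \<in> {n - p..<n}. k < j}"

text \<open>The two bounds lead to the two members of \<open>min p (1 / (1 - q))\<close> in the
  final estimate.\<close>

lemma vp_weight_le:
  assumes "p \<le> n"
  shows "vp_weight n p j \<le> p" "vp_weight n p j \<le> j - (n - p)"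
proof -
  have "vp_weight n p j \<le> card {n - p..<n}"
    unfolding vp_weight_def by (intro card_mono) auto
  then show "vp_weight n p j \<le> p" using assms by simp
  have "vp_weight n p j \<le> card {n - p..<j}"
    unfolding vp_weight_def by (intro card_mono) auto
  then show "vp_weight n p j \<le> j - (n - p)" by simp
qed

text \<open>Here \<open>p * (f - V)\<close> is a sum of \<open>p\<close> tails of the Fourier
  series, and harmonic \<open>j\<close> lies in the tail beyond \<open>k\<close> exactly when
  \<open>k < j\<close>. Exchanging the finite sum with the series collects these occurrences in
  \<open>vp_weight\<close>.\<close>

lemma vallee_poussin_remainder_sums:
  assumes f: "f \<in> C_space" and pn: "1 \<le> p" "p \<le> n"
    and a: "summable (\<lambda>j. \<bar>fourier_a f j\<bar>)" and b: "summable (\<lambda>j. \<bar>fourier_b f j\<bar>)"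
  shows "(\<lambda>j. real (vp_weight n p j) *
            (fourier_a f j * cos (real j * x) + fourier_b f j * sin (real j * x)))
         sums (real p * (f x - vallee_poussin_sum n p f x))"
proof -
  define u where "u j = (if j = 0 then fourier_a f 0 / 2 else fourier_a f j) * cos (real j * x)
            + fourier_b f j * sin (real j * x)" for j
  have u: "u sums f x"
    using C_space_fourier_series_sums[OF f a b, of x] by (simp add: u_def[abs_def])
  have S: "fourier_partial_sum k f x = (\<Sum>j\<le>k. u j)" for k
  proof -
    have "(\<Sum>j\<le>k. u j) = u 0 + (\<Sum>j=1..k. u j)"
      by (simp add: atMost_atLeast0 sum.atLeast_Suc_atMost)
    then show ?thesis by (simp add: fourier_partial_sum_def u_def)
  qed
  have "(\<lambda>j. if k < j then u j else 0) sums (f x - fourier_partial_sum k f x)" for k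
  proof -
    have "(\<lambda>j. if j \<in> {..k} then u j else 0) sums (\<Sum>j\<le>k. u j)"
      by (rule sums_If_finite_set) simp
    from sums_diff[OF u this] have "(\<lambda>j. u j - (if j \<in> {..k} then u j else 0)) sums (f x - fourier_partial_sum k f x)"
      unfolding S .
    moreover have "(\<lambda>j. u j - (if j \<in> {..k} then u j else 0)) = (\<lambda>j. if k < j then u j else 0)"
      by auto
    ultimately show ?thesis by simp
  qed
  then have "(\<lambda>j. \<Sum>k\<in>{n - p..<n}. if k < j then u j else 0)
      sums (\<Sum>k\<in>{n - p..<n}. f x - fourier_partial_sum k f x)"
    by (intro sums_sum) auto
  also have "(\<lambda>j. \<Sum>k\<in>{n - p..<n}. if k < j then u j else 0) = (\<lambda>j. real (vp_weight n p j) * u j)"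
    unfolding vp_weight_def by (auto simp: sum.inter_filter[symmetric])
  \<comment> \<open>The halved constant term in \<open>u 0\<close> makes no difference, since the
    weight at \<open>j = 0\<close> is zero.\<close>
  also have "(\<lambda>j. real (vp_weight n p j) * u j) = (\<lambda>j. real (vp_weight n p j) *
            (fourier_a f j * cos (real j * x) + fourier_b f j * sin (real j * x)))"
    by (auto simp: u_def vp_weight_def)
  also have "(\<Sum>k\<in>{n - p..<n}. f x - fourier_partial_sum k f x) =
      real p * (f x - vallee_poussin_sum n p f x)"
    using pn by (simp add: sum_subtractf vallee_poussin_sum_def right_diff_distrib)
  finally show ?thesis .
qed

section \<open>Summable multipliers and class errors as suprema over derivatives\<close>

lemma D_set_pos: "\<psi> \<in> D_set q \<Longrightarrow> k \<ge> 1 \<Longrightarrow> \<psi> k > 0"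
  by (simp add: D_set_def)

text \<open>Ratio test with a constant strictly between \<open>q\<close> and
  \<open>1\<close>.\<close>

lemma D_set_summable:
  assumes "\<psi> \<in> D_set q" "q < 1"
  shows "summable \<psi>"
proof -
  obtain c where c: "q < c" "c < 1" using assms(2) dense by blast
  have "eventually (\<lambda>k. \<psi> (k + 1) / \<psi> k < c) sequentially"
    using assms(1) c(1) by (auto simp: D_set_def dest: order_tendstoD)
  then obtain N where N: "\<And>k. k \<ge> N \<Longrightarrow> \<psi> (k + 1) / \<psi> k < c"
    by (auto simp: eventually_sequentially)
  show ?thesis
  proof (rule summable_ratio_test[OF c(2), of "max 1 N"])
    fix k assume k: "max 1 N \<le> k"
    have "\<psi> k > 0" "\<psi> (Suc k) > 0" using D_set_pos[OF assms(1)] k by auto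
    then show "norm (\<psi> (Suc k)) \<le> c * norm (\<psi> k)"
      using N[of k] k by (simp add: field_simps)
  qed
qed

lemma power_in_D_set:
  assumes "0 < q"
  shows "(\<lambda>k. q ^ k) \<in> D_set q"
proof -
  have "(\<lambda>k. q ^ (k + 1) / q ^ k) = (\<lambda>k. q)" using assms by auto
  then show ?thesis using assms by (simp add: D_set_def)
qed

text \<open>This is \<open>p\<close> times the deviation, expressed through the derivative alone, so
  that different \<open>\<psi>\<close> can be compared for one fixed \<open>\<phi>\<close>.\<close>

definition vp_remainder_series ::
  "nat \<Rightarrow> nat \<Rightarrow> (nat \<Rightarrow> real) \<Rightarrow> real \<Rightarrow> (real \<Rightarrow> real) \<Rightarrow> real \<Rightarrow> real" where
  "vp_remainder_series n p \<psi> \<beta> \<phi> x =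
     (\<Sum>j. real (vp_weight n p j) * \<psi> j * rotated_harmonic \<beta> \<phi> j x)"

text \<open>The coefficients of \<open>\<phi>\<close> are bounded and \<open>\<psi>\<close> is
  summable, so those of \<open>f\<close> are absolutely summable and the deviation is given by its
  series.\<close>

lemma psi_beta_derivative_remainder:
  assumes \<psi>: "\<psi> \<in> D_set q" "q < 1" and pn: "1 \<le> p" "p \<le> n"
    and f: "f \<in> C_space" and d: "is_psi_beta_derivative \<psi> \<beta> f \<phi>"
  shows "(\<lambda>j. real (vp_weight n p j) * \<psi> j * rotated_harmonic \<beta> \<phi> j x)
          sums (real p * (f x - vallee_poussin_sum n p f x))" (is ?S)
    and "real p * (f x - vallee_poussin_sum n p f x) = vp_remainder_series n p \<psi> \<beta> \<phi> x"
proof -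
  have L: "\<phi> \<in> L_space 1" using d by (simp add: is_psi_beta_derivative_def)
  define B where "B = (1 / pi) * (\<integral>t. \<bar>\<phi> t\<bar> \<partial>lebesgue_on {0..2 * pi})"
  have G: "\<bar>rotated_harmonic \<beta> \<phi> j x\<bar> \<le> 2 * B" for j x
    using abs_rotated_harmonic_le[of \<beta> \<phi> j x] abs_fourier_le[OF L, of j] unfolding B_def by linarith
  have h: "fourier_a f j * cos (real j * x) + fourier_b f j * sin (real j * x) =
           \<psi> j * rotated_harmonic \<beta> \<phi> j x" if "j \<ge> 1" for j x
    using psi_beta_derivative_harmonic[OF d that] D_set_pos[OF \<psi>(1) that] by simp
  have bd: "\<bar>\<psi> j * rotated_harmonic \<beta> \<phi> j x\<bar> \<le> \<psi> j * (2 * B)" if "j \<ge> 1" for j x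
    using D_set_pos[OF \<psi>(1) that] G by (simp add: abs_mult)
  have sum: "summable (\<lambda>j. \<psi> j * (2 * B))"
    by (intro summable_mult2 D_set_summable[OF \<psi>])
  have a: "summable (\<lambda>j. \<bar>fourier_a f j\<bar>)"
  proof (rule summable_comparison_test'[OF sum, of 1])
    fix j :: nat assume j: "1 \<le> j"
    show "norm \<bar>fourier_a f j\<bar> \<le> \<psi> j * (2 * B)"
      using h[OF j, of 0] bd[OF j, of 0] by simp
  qed
  have b: "summable (\<lambda>j. \<bar>fourier_b f j\<bar>)"
  proof (rule summable_comparison_test'[OF sum, of 1])
    fix j :: nat assume j: "1 \<le> j"
    \<comment> \<open>At this point the cosine vanishes and the sine equals one, which isolates
      \<open>fourier_b f j\<close>; the point \<open>0\<close> served the same purpose for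
      \<open>fourier_a f j\<close>.\<close>
    define y where "y = pi / 2 / real j"
    have y: "real j * y = pi / 2" using j by (simp add: y_def)
    show "norm \<bar>fourier_b f j\<bar> \<le> \<psi> j * (2 * B)"
      using h[OF j, of y] bd[OF j, of y] unfolding y by simp
  qed
  \<comment> \<open>The value \<open>\<psi> 0\<close> is unconstrained, so \<open>j = 0\<close> is
    handled through its zero weight.\<close>
  have e: "real (vp_weight n p j) * (fourier_a f j * cos (real j * x) + fourier_b f j * sin (real j * x))
      = real (vp_weight n p j) * \<psi> j * rotated_harmonic \<beta> \<phi> j x" for j
  proof (cases "j = 0")
    case True
    then show ?thesis by (simp add: vp_weight_def)
  next
    case False
    then show ?thesis using h[of j x] by (simp add: mult.assoc)
  qed
  show ?S
    using vallee_poussin_remainder_sums[OF f pn a b, of x] unfolding e .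
  then show "real p * (f x - vallee_poussin_sum n p f x) = vp_remainder_series n p \<psi> \<beta> \<phi> x"
    unfolding vp_remainder_series_def by (rule sums_unique)
qed

text \<open>Each harmonic of \<open>\<phi>\<close> is rotated by \<open>\<beta> * pi / 2\<close> and
  scaled by \<open>\<psi> j\<close>; the resulting series converges absolutely to a continuous
  function. Since this works for \<open>\<psi>\<close> and for \<open>q^k\<close> alike, the same
  functions \<open>\<phi>\<close> are admissible for both classes.\<close>

lemma psi_beta_antiderivative_exists:
  assumes \<psi>: "\<psi> \<in> D_set q" "q < 1" and L: "\<phi> \<in> L_space 1" and z: "fourier_a \<phi> 0 = 0"
  obtains f where "f \<in> C_space" "is_psi_beta_derivative \<psi> \<beta> f \<phi>"
proof -
  define B where "B = (1 / pi) * (\<integral>t. \<bar>\<phi> t\<bar> \<partial>lebesgue_on {0..2 * pi})"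
  let ?\<theta> = "\<beta> * pi / 2"
  define c where "c j = \<psi> j * (fourier_a \<phi> j * cos ?\<theta> - fourier_b \<phi> j * sin ?\<theta>)" for j
  define d where "d j = \<psi> j * (fourier_a \<phi> j * sin ?\<theta> + fourier_b \<phi> j * cos ?\<theta>)" for j
  have sum: "summable (\<lambda>j. \<psi> j * (2 * B))"
    by (intro summable_mult2 D_set_summable[OF \<psi>])
  have ab: "\<bar>fourier_a \<phi> j\<bar> + \<bar>fourier_b \<phi> j\<bar> \<le> 2 * B" for j
    using abs_fourier_le[OF L, of j] unfolding B_def by linarith
  have c: "summable (\<lambda>j. \<bar>c j\<bar>)"
  proof (rule summable_comparison_test'[OF sum, of 1])
    fix j :: nat assume j: "1 \<le> j"
    show "norm \<bar>c j\<bar> \<le> \<psi> j * (2 * B)"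
      using D_set_pos[OF \<psi>(1) j] ab[of j] abs_harmonic_le[of "fourier_a \<phi> j" ?\<theta> "- fourier_b \<phi> j"]
      by (simp add: c_def abs_mult)
  qed
  have d: "summable (\<lambda>j. \<bar>d j\<bar>)"
  proof (rule summable_comparison_test'[OF sum, of 1])
    fix j :: nat assume j: "1 \<le> j"
    show "norm \<bar>d j\<bar> \<le> \<psi> j * (2 * B)"
      using D_set_pos[OF \<psi>(1) j] ab[of j] abs_harmonic_le[of "fourier_b \<phi> j" ?\<theta> "fourier_a \<phi> j"]
      by (simp add: d_def abs_mult add.commute)
  qed
  let ?f = "\<lambda>x. \<Sum>j. c j * cos (real j * x) + d j * sin (real j * x)"
  note f = trig_series[OF c d]
  have "fourier_a \<phi> k * cos (real k * x) + fourier_b \<phi> k * sin (real k * x) =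
        1 / \<psi> k * (fourier_a ?f k * cos (real k * x + ?\<theta>) + fourier_b ?f k * sin (real k * x + ?\<theta>))"
    if k: "k \<ge> 1" for k x
  proof -
    \<comment> \<open>Rotating both vectors \<open>(A, B)\<close> and \<open>(X, Y)\<close> by the
      same angle preserves their inner product.\<close>
    have sc: "(A * C - B * S) * (X * C - Y * S) + (A * S + B * C) * (Y * C + X * S) = A * X + B * Y"
      if "S * S + C * C = 1" for A B C S X Y :: real
    proof -
      have "(A * C - B * S) * (X * C - Y * S) + (A * S + B * C) * (Y * C + X * S)
          = (A * X + B * Y) * (S * S + C * C)" by (simp add: algebra_simps)
      then show ?thesis using that by simp
    qed
    have "1 / \<psi> k * (c k * cos (real k * x + ?\<theta>) + d k * sin (real k * x + ?\<theta>)) =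
      (fourier_a \<phi> k * cos ?\<theta> - fourier_b \<phi> k * sin ?\<theta>) * cos (real k * x + ?\<theta>)
      + (fourier_a \<phi> k * sin ?\<theta> + fourier_b \<phi> k * cos ?\<theta>) * sin (real k * x + ?\<theta>)"
      using D_set_pos[OF \<psi>(1) k] by (simp add: c_def d_def field_simps)
    also have "\<dots> = fourier_a \<phi> k * cos (real k * x) + fourier_b \<phi> k * sin (real k * x)"
      unfolding cos_add sin_add by (rule sc) (simp add: power2_eq_square[symmetric])
    finally show ?thesis using k by (simp only: f(3,4)) simp
  qed
  then have "is_psi_beta_derivative \<psi> \<beta> ?f \<phi>"
    using L z unfolding is_psi_beta_derivative_def by blast
  with f(2) show ?thesis using that by blast
qed

text \<open>All continuous \<open>f\<close> with the same derivative have the same deviation, and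
  every admissible \<open>\<phi>\<close> is a derivative. The index set on the right does not
  involve \<open>\<psi>\<close>.\<close>

lemma class_error_C_class:
  assumes \<psi>: "\<psi> \<in> D_set q" "q < 1" and pn: "1 \<le> p" "p \<le> n"
  shows "class_error (C_class \<psi> \<beta> \<NN>) n p =
    (SUP \<phi>\<in>{\<phi> \<in> \<NN>. \<phi> \<in> L_space 1 \<and> fourier_a \<phi> 0 = 0}.
       C_norm (\<lambda>x. vp_remainder_series n p \<psi> \<beta> \<phi> x / real p))"
proof -
  let ?N = "{\<phi> \<in> \<NN>. \<phi> \<in> L_space 1 \<and> fourier_a \<phi> 0 = 0}"
  have eq: "C_norm (\<lambda>x. f x - vallee_poussin_sum n p f x) =
      C_norm (\<lambda>x. vp_remainder_series n p \<psi> \<beta> \<phi> x / real p)"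
    if "f \<in> C_space" "is_psi_beta_derivative \<psi> \<beta> f \<phi>" for f \<phi>
    using psi_beta_derivative_remainder(2)[OF \<psi> pn that, symmetric] pn by simp
  have "(\<lambda>f. C_norm (\<lambda>x. f x - vallee_poussin_sum n p f x)) ` C_class \<psi> \<beta> \<NN> =
      (\<lambda>\<phi>. C_norm (\<lambda>x. vp_remainder_series n p \<psi> \<beta> \<phi> x / real p)) ` ?N"
  proof (intro equalityI subsetI)
    fix y assume "y \<in> (\<lambda>f. C_norm (\<lambda>x. f x - vallee_poussin_sum n p f x)) ` C_class \<psi> \<beta> \<NN>"
    then obtain f \<phi> where f: "f \<in> C_space" "\<phi> \<in> \<NN>" "is_psi_beta_derivative \<psi> \<beta> f \<phi>"
      and y: "y = C_norm (\<lambda>x. f x - vallee_poussin_sum n p f x)"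
      unfolding C_class_def L_class_def by blast
    have "\<phi> \<in> ?N" using f by (simp add: is_psi_beta_derivative_def)
    then show "y \<in> (\<lambda>\<phi>. C_norm (\<lambda>x. vp_remainder_series n p \<psi> \<beta> \<phi> x / real p)) ` ?N"
      unfolding y eq[OF f(1,3)] by (rule imageI)
  next
    fix y assume "y \<in> (\<lambda>\<phi>. C_norm (\<lambda>x. vp_remainder_series n p \<psi> \<beta> \<phi> x / real p)) ` ?N"
    then obtain \<phi> where \<phi>: "\<phi> \<in> \<NN>" "\<phi> \<in> L_space 1" "fourier_a \<phi> 0 = 0"
      and y: "y = C_norm (\<lambda>x. vp_remainder_series n p \<psi> \<beta> \<phi> x / real p)" by blast
    obtain f where f: "f \<in> C_space" "is_psi_beta_derivative \<psi> \<beta> f \<phi>"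
      using psi_beta_antiderivative_exists[OF \<psi> \<phi>(2,3)] .
    then have "f \<in> C_class \<psi> \<beta> \<NN>"
      using \<phi>(1) C_space_subset_L_space_1 unfolding C_class_def L_class_def by blast
    then show "y \<in> (\<lambda>f. C_norm (\<lambda>x. f x - vallee_poussin_sum n p f x)) ` C_class \<psi> \<beta> \<NN>"
      unfolding y eq[OF f, symmetric] by (rule imageI)
  qed
  then show ?thesis unfolding class_error_def by simp
qed

subsection \<open>Perturbation of geometric sequences\<close>

text \<open>Multiplication by \<open>1 - r\<close> telescopes \<open>C\<close> to
  \<open>2 * B\<close>, \<open>B\<close> to \<open>A\<close> and \<open>A\<close> to
  \<open>1\<close>, each up to a nonnegative boundary term that is dropped.\<close>

lemma geometric_moment_bounds:
  fixes r :: real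
  assumes "0 \<le> r" "r < 1"
  shows "(\<Sum>i<n. real i * r ^ (i - 1)) \<le> 1 / (1 - r)\<^sup>2"
    and "(\<Sum>i<n. real i * real (i + 1) * r ^ (i - 1)) \<le> 2 / (1 - r) ^ 3"
proof -
  define A where "A n = (\<Sum>i<n. r ^ i)" for n
  define B where "B n = (\<Sum>i<n. real (i + 1) * r ^ i)" for n
  define C where "C n = (\<Sum>i<n. real (i + 1) * real (i + 2) * r ^ i)" for n
  have div: "y \<le> x / (1 - r)" if "(1 - r) * y \<le> x" for x y
    using that assms(2) by (simp add: pos_le_divide_eq mult.commute)
  have "(1 - r) * A n + r ^ n = 1" for n
  proof (induction n)
    case (Suc n)
    have "(1 - r) * A (Suc n) + r ^ Suc n = (1 - r) * A n + r ^ n" by (simp add: A_def algebra_simps)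
    then show ?case using Suc by simp
  qed (simp add: A_def)
  then have A: "A n \<le> 1 / (1 - r)" for n
    using assms by (intro div) (smt (verit) zero_le_power)
  have "(1 - r) * B n + real n * r ^ n = A n" for n
  proof (induction n)
    case (Suc n)
    have "(1 - r) * B (Suc n) + real (Suc n) * r ^ Suc n = ((1 - r) * B n + real n * r ^ n) + r ^ n"
      by (simp add: B_def algebra_simps)
    then show ?case using Suc by (simp add: A_def)
  qed (simp add: A_def B_def)
  then have "(1 - r) * B n \<le> A n" for n
    using assms by (smt (verit) mult_nonneg_nonneg of_nat_0_le_iff zero_le_power)
  then have "B n \<le> A n / (1 - r)" for n by (rule div)
  then have "B n \<le> 1 / (1 - r) / (1 - r)" for n
    using A[of n] assms(2) by (meson divide_right_mono diff_ge_0_iff_ge less_imp_le order_trans)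
  then have B: "B n \<le> 1 / (1 - r)\<^sup>2" for n
    by (simp add: power2_eq_square)
  have "(1 - r) * C n + real n * real (n + 1) * r ^ n = 2 * B n" for n
  proof (induction n)
    case (Suc n)
    have "(1 - r) * C (Suc n) + real (Suc n) * real (Suc n + 1) * r ^ Suc n =
        ((1 - r) * C n + real n * real (n + 1) * r ^ n) + 2 * (real (n + 1) * r ^ n)"
      by (simp add: C_def algebra_simps)
    then show ?case using Suc by (simp add: B_def)
  qed (simp add: B_def C_def)
  then have "(1 - r) * C n \<le> 2 * B n" for n
    using assms by (smt (verit) mult_nonneg_nonneg of_nat_0_le_iff zero_le_power)
  then have "C n \<le> 2 * B n / (1 - r)" for n by (rule div)
  then have "C n \<le> 2 * (1 / (1 - r)\<^sup>2) / (1 - r)" for n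
    using mult_left_mono[OF B[of n], of 2] assms(2)
    by (meson divide_right_mono diff_ge_0_iff_ge less_imp_le order_trans zero_le_numeral)
  then have C: "C n \<le> 2 / (1 - r) ^ 3" for n
    by (simp add: power2_eq_square power3_eq_cube)
  \<comment> \<open>One extra term is added so that, after the vanishing term \<open>i = 0\<close>
    is split off, the shifted sum is exactly \<open>B n\<close>.\<close>
  have "(\<Sum>i<n. real i * r ^ (i - 1)) \<le> (\<Sum>i<Suc n. real i * r ^ (i - 1))"
    using assms by simp
  also have "\<dots> = B n" by (subst sum.lessThan_Suc_shift) (simp add: B_def)
  finally show "(\<Sum>i<n. real i * r ^ (i - 1)) \<le> 1 / (1 - r)\<^sup>2" using B by (rule order_trans)
  have "(\<Sum>i<n. real i * real (i + 1) * r ^ (i - 1)) \<le> (\<Sum>i<Suc n. real i * real (i + 1) * r ^ (i - 1))"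
    using assms by simp
  also have "\<dots> = C n" by (subst sum.lessThan_Suc_shift) (simp add: C_def add.commute)
  finally show "(\<Sum>i<n. real i * real (i + 1) * r ^ (i - 1)) \<le> 2 / (1 - r) ^ 3"
    using C by (rule order_trans)
qed

text \<open>The ratios converge, so the set under the real supremum is bounded.\<close>

lemma ratio_dev_upper:
  assumes "\<psi> \<in> D_set q" "k \<ge> m"
  shows "\<bar>\<psi> (k + 1) / \<psi> k - q\<bar> \<le> ratio_dev \<psi> q m"
  unfolding ratio_dev_def
proof (rule cSUP_upper)
  have "convergent (\<lambda>k. \<bar>\<psi> (k + 1) / \<psi> k - q\<bar>)"
    using assms(1) unfolding D_set_def convergent_def by (auto intro!: tendsto_intros exI)
  then have "Bseq (\<lambda>k. \<bar>\<psi> (k + 1) / \<psi> k - q\<bar>)" by (rule convergent_imp_Bseq)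
  then obtain B where "\<And>k. norm \<bar>\<psi> (k + 1) / \<psi> k - q\<bar> \<le> B" by (auto simp: Bseq_def)
  then show "bdd_above ((\<lambda>k. \<bar>\<psi> (k + 1) / \<psi> k - q\<bar>) ` {m..})"
    by (intro bdd_aboveI2[where M = B]) auto
qed (use assms in simp)

lemma ratio_dev_nonneg: "\<psi> \<in> D_set q \<Longrightarrow> 0 \<le> ratio_dev \<psi> q m"
  using ratio_dev_upper[of \<psi> q m m] by linarith

lemma ratio_dev_eventually_le:
  assumes "\<psi> \<in> D_set q" "e > 0"
  obtains N where "\<And>m. m \<ge> N \<Longrightarrow> ratio_dev \<psi> q m \<le> e"
proof -
  have "eventually (\<lambda>k. dist (\<psi> (k + 1) / \<psi> k) q < e) sequentially"
    using assms by (auto simp: D_set_def dest: tendstoD)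
  then obtain N where N: "\<And>k. k \<ge> N \<Longrightarrow> \<bar>\<psi> (k + 1) / \<psi> k - q\<bar> < e"
    by (auto simp: eventually_sequentially dist_real_def)
  have "ratio_dev \<psi> q m \<le> e" if "m \<ge> N" for m
    unfolding ratio_dev_def
  proof (rule cSUP_least)
    fix k assume "k \<in> {m..}"
    then show "\<bar>\<psi> (k + 1) / \<psi> k - q\<bar> \<le> e" using N[of k] that by simp
  qed simp
  then show ?thesis using that by blast
qed

text \<open>With \<open>u\<close> the normalised sequence and \<open>v\<close> its ratios,
  \<open>u (i+1) - q^(i+1) = (v i - q) * u i + q * (u i - q^i)\<close>. As \<open>r\<close>
  dominates both \<open>q\<close> and all \<open>v i\<close>, the first summand contributes at most
  \<open>ratio_dev * r^i\<close> and the second propagates the old error by a factor at most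
  \<open>r\<close>.\<close>

lemma D_set_ratio_power_diff:
  assumes \<psi>: "\<psi> \<in> D_set q" and q: "0 < q" and m: "m \<ge> 1"
    and r: "q + ratio_dev \<psi> q m \<le> r"
  shows "\<bar>\<psi> (m + i) / \<psi> m - q ^ i\<bar> \<le> ratio_dev \<psi> q m * (real i * r ^ (i - 1))"
proof -
  let ?e = "ratio_dev \<psi> q m"
  have e0: "?e \<ge> 0" by (rule ratio_dev_nonneg[OF \<psi>])
  have r0: "r > 0" "q \<le> r" using r q e0 by auto
  have pos: "\<psi> (m + i) > 0" for i using D_set_pos[OF \<psi>] m by simp
  define u where "u i = \<psi> (m + i) / \<psi> m" for i
  define v where "v i = \<psi> (m + i + 1) / \<psi> (m + i)" for i
  have u0: "u i > 0" for i using pos[of i] pos[of 0] by (simp add: u_def)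
  have us: "u (Suc i) = v i * u i" for i using pos[of i] by (simp add: u_def v_def)
  have v: "\<bar>v i - q\<bar> \<le> ?e" for i
    using ratio_dev_upper[OF \<psi>, of m "m + i"] by (simp add: v_def)
  have vr: "v i \<le> r" for i using v[of i] r by linarith
  have ur: "u i \<le> r ^ i" for i
  proof (induction i)
    case 0
    then show ?case using pos[of 0] by (simp add: u_def)
  next
    case (Suc i)
    then show ?case unfolding us using vr[of i] u0[of i] r0 by (auto intro: mult_mono)
  qed
  have "\<bar>u i - q ^ i\<bar> \<le> ?e * (real i * r ^ (i - 1))"
  proof (induction i)
    case 0
    then show ?case using pos[of 0] by (simp add: u_def)
  next
    case (Suc i)
    have "\<bar>u (Suc i) - q ^ Suc i\<bar> = \<bar>(v i - q) * u i + q * (u i - q ^ i)\<bar>"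
      by (simp add: us[of i] algebra_simps)
    also have "\<dots> \<le> \<bar>(v i - q) * u i\<bar> + \<bar>q * (u i - q ^ i)\<bar>"
      by (rule abs_triangle_ineq)
    also have "\<dots> = \<bar>v i - q\<bar> * u i + q * \<bar>u i - q ^ i\<bar>"
      using u0[of i] q by (simp add: abs_mult)
    also have "\<dots> \<le> ?e * r ^ i + r * (?e * (real i * r ^ (i - 1)))"
      using v[of i] u0[of i] ur[of i] Suc r0 q e0 by (intro add_mono mult_mono) auto
    also have "\<dots> = ?e * (real (Suc i) * r ^ (Suc i - 1))"
      by (cases i) (simp_all add: algebra_simps)
    finally show ?case .
  qed
  then show "\<bar>\<psi> (m + i) / \<psi> m - q ^ i\<bar> \<le> ?e * (real i * r ^ (i - 1))" unfolding u_def .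
qed

text \<open>The bound passes to the limit of the partial sums; the vanishing first \<open>m\<close>
  terms reflect that low harmonics are reproduced exactly.\<close>

lemma sums_abs_le:
  fixes t :: "nat \<Rightarrow> real"
  assumes "t sums X" and z: "\<And>j. j < m \<Longrightarrow> t j = 0"
    and B: "\<And>N. (\<Sum>i<N. \<bar>t (m + i)\<bar>) \<le> B"
  shows "\<bar>X\<bar> \<le> B"
proof (rule LIMSEQ_le_const2)
  show "(\<lambda>N. \<bar>\<Sum>i<N. t i\<bar>) \<longlonglongrightarrow> \<bar>X\<bar>"
    using assms(1) unfolding sums_def by (rule tendsto_rabs)
  have "\<bar>\<Sum>i<N. t i\<bar> \<le> B" for N
  proof -
    have "\<bar>\<Sum>i<N. t i\<bar> \<le> (\<Sum>i<N. \<bar>t i\<bar>)" by (rule sum_abs)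
    also have "\<dots> \<le> (\<Sum>i<m + N. \<bar>t i\<bar>)" by (rule sum_mono2) auto
    also have "\<dots> = (\<Sum>i<m. \<bar>t i\<bar>) + (\<Sum>i<N. \<bar>t (m + i)\<bar>)"
      by (induction N) simp_all
    also have "\<dots> = (\<Sum>i<N. \<bar>t (m + i)\<bar>)" using z by simp
    also have "\<dots> \<le> B" by (rule B)
    finally show ?thesis .
  qed
  then show "\<exists>N. \<forall>n\<ge>N. \<bar>\<Sum>i<n. t i\<bar> \<le> B" by blast
qed

text \<open>Pointwise closeness carries over to suprema. It is used on two levels: over points
  \<open>x\<close> inside \<open>C_norm\<close>, and over the functions of the class.\<close>

lemma SUP_scaled_diff_le:
  fixes f g :: "'a \<Rightarrow> real"
  assumes "A \<noteq> {}" "c > 0" "d > 0" "bdd_above (f ` A)" "bdd_above (g ` A)"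
    and le: "\<And>a. a \<in> A \<Longrightarrow> \<bar>c * f a - d * g a\<bar> \<le> e"
  shows "\<bar>c * (SUP a\<in>A. f a) - d * (SUP a\<in>A. g a)\<bar> \<le> e"
proof -
  \<comment> \<open>Stated for arbitrary \<open>c\<close>, \<open>d\<close>, \<open>f\<close>,
    \<open>g\<close>, so that exchanging the roles gives the opposite inequality.\<close>
  have *: "c * (SUP a\<in>A. f a) \<le> d * (SUP a\<in>A. g a) + e"
    if "c > 0" "d > 0" "bdd_above (g ` A)" "\<And>a. a \<in> A \<Longrightarrow> c * f a \<le> d * g a + e"
    for c d and f g :: "'a \<Rightarrow> real"
  proof -
    have "(SUP a\<in>A. f a) \<le> (d * (SUP a\<in>A. g a) + e) / c"
    proof (rule cSUP_least[OF assms(1)])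
      fix a assume a: "a \<in> A"
      have "c * f a \<le> d * (SUP a\<in>A. g a) + e"
        using that(4)[OF a] mult_left_mono[OF cSUP_upper[OF a that(3)], of d] that(2) by linarith
      then show "f a \<le> (d * (SUP a\<in>A. g a) + e) / c"
        using that(1) by (simp add: field_simps)
    qed
    then show ?thesis using that(1) by (simp add: field_simps)
  qed
  have "c * f a \<le> d * g a + e" "d * g a \<le> c * f a + e" if "a \<in> A" for a
    using le[OF that] by linarith+
  then have "c * (SUP a\<in>A. f a) \<le> d * (SUP a\<in>A. g a) + e"
    "d * (SUP a\<in>A. g a) \<le> c * (SUP a\<in>A. f a) + e"
    by (intro * assms; blast)+
  then show ?thesis by linarith
qed

subsection \<open>Comparison of the class errors\<close>

lemma vp_remainder_series_sums:
  assumes "\<psi> \<in> D_set q" "q < 1" "1 \<le> p" "p \<le> n" "\<phi> \<in> L_space 1" "fourier_a \<phi> 0 = 0"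
  shows "(\<lambda>j. real (vp_weight n p j) * \<psi> j * rotated_harmonic \<beta> \<phi> j x)
    sums vp_remainder_series n p \<psi> \<beta> \<phi> x"
proof -
  obtain f where f: "f \<in> C_space" "is_psi_beta_derivative \<psi> \<beta> f \<phi>"
    using psi_beta_antiderivative_exists[OF assms(1,2,5,6)] .
  show ?thesis
    using psi_beta_derivative_remainder[OF assms(1-4) f] by simp
qed

lemma vp_weight_eq_0: "j < n - p + 1 \<Longrightarrow> vp_weight n p j = 0"
  by (auto simp: vp_weight_def)

lemma vp_weight_shift_le: "p \<le> n \<Longrightarrow> vp_weight n p (n - p + 1 + i) \<le> i + 1"
  using vp_weight_le(2)[of p n "n - p + 1 + i"] by simp

text \<open>A crude bound, uniform in \<open>\<phi>\<close> and \<open>x\<close>, that makes the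
  suprema in the class errors finite.\<close>

lemma abs_vp_remainder_series_le:
  assumes \<psi>: "\<psi> \<in> D_set q" "q < 1" and pn: "1 \<le> p" "p \<le> n"
    and \<phi>: "\<phi> \<in> L_space 1" "fourier_a \<phi> 0 = 0"
    and G: "\<And>k x. k \<ge> n - p + 1 \<Longrightarrow> \<bar>rotated_harmonic \<beta> \<phi> k x\<bar> \<le> G"
  shows "\<bar>vp_remainder_series n p \<psi> \<beta> \<phi> x\<bar> \<le> real p * G * (\<Sum>i. \<psi> (n - p + 1 + i))"
proof (rule sums_abs_le[OF vp_remainder_series_sums[OF \<psi> pn \<phi>]])
  let ?m = "n - p + 1"
  have G0: "G \<ge> 0" using G[of ?m 0] by linarith
  have pos: "\<psi> (?m + i) > 0" for i using D_set_pos[OF \<psi>(1)] by simp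
  have summ: "summable (\<lambda>i. \<psi> (?m + i))"
    using D_set_summable[OF \<psi>] summable_iff_shift[of \<psi> ?m] by (simp add: add.commute)
  fix N
  have "\<bar>real (vp_weight n p (?m + i)) * \<psi> (?m + i) * rotated_harmonic \<beta> \<phi> (?m + i) x\<bar>
      \<le> real p * \<psi> (?m + i) * G" for i
    unfolding abs_mult using vp_weight_le(1)[OF pn(2), of "?m + i"] pos[of i] G[of "?m + i" x]
    by (intro mult_mono) auto
  then have "(\<Sum>i<N. \<bar>real (vp_weight n p (?m + i)) * \<psi> (?m + i) * rotated_harmonic \<beta> \<phi> (?m + i) x\<bar>)
      \<le> (\<Sum>i<N. real p * \<psi> (?m + i) * G)"
    by (rule sum_mono)
  also have "\<dots> = real p * G * (\<Sum>i<N. \<psi> (?m + i))"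
    by (simp add: sum_distrib_left mult_ac)
  also have "\<dots> \<le> real p * G * (\<Sum>i. \<psi> (?m + i))"
    using G0 pos by (intro mult_left_mono sum_le_suminf summ) (auto intro: less_imp_le)
  finally show "(\<Sum>i<N. \<bar>real (vp_weight n p (?m + i)) * \<psi> (?m + i) * rotated_harmonic \<beta> \<phi> (?m + i) x\<bar>)
      \<le> real p * G * (\<Sum>i. \<psi> (?m + i))" .
qed (simp add: vp_weight_eq_0)

lemma vp_remainder_series_diff:
  assumes \<psi>: "\<psi> \<in> D_set q" and q: "0 < q" "q < 1" and pn: "1 \<le> p" "p \<le> n"
    and \<phi>: "\<phi> \<in> L_space 1" "fourier_a \<phi> 0 = 0"
    and G: "\<And>k x. k \<ge> n - p + 1 \<Longrightarrow> \<bar>rotated_harmonic \<beta> \<phi> k x\<bar> \<le> G"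
    and small: "ratio_dev \<psi> q (n - p + 1) \<le> (1 - q) / 2"
  shows "\<bar>vp_remainder_series n p \<psi> \<beta> \<phi> x / \<psi> (n - p + 1) -
          vp_remainder_series n p (\<lambda>k. q ^ k) \<beta> \<phi> x / q ^ (n - p + 1)\<bar>
     \<le> G * (16 * (ratio_dev \<psi> q (n - p + 1) / (1 - q)\<^sup>2) * min (real p) (1 / (1 - q)))"
proof -
  let ?m = "n - p + 1"
  \<comment> \<open>The midpoint of \<open>q\<close> and \<open>1\<close>: the hypothesis
    \<open>small\<close> says precisely that \<open>q + ratio_dev\<close> stays below it, and
    \<open>1 - r\<close> is still half of \<open>1 - q\<close>.\<close>
  define r where "r = (1 + q) / 2"
  have r: "0 \<le> r" "r < 1" "q + ratio_dev \<psi> q ?m \<le> r" "1 - r = (1 - q) / 2"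
    using q small by (auto simp: r_def field_simps)
  let ?e = "ratio_dev \<psi> q ?m"
  have e0: "?e \<ge> 0" by (rule ratio_dev_nonneg[OF \<psi>])
  have G0: "G \<ge> 0" using G[of ?m 0] by linarith
  define t where "t j = real (vp_weight n p j) * (\<psi> j / \<psi> ?m - q ^ j / q ^ ?m) *
      rotated_harmonic \<beta> \<phi> j x" for j
  have "(\<lambda>j. real (vp_weight n p j) * \<psi> j * rotated_harmonic \<beta> \<phi> j x / \<psi> ?m -
      real (vp_weight n p j) * q ^ j * rotated_harmonic \<beta> \<phi> j x / q ^ ?m)
    sums (vp_remainder_series n p \<psi> \<beta> \<phi> x / \<psi> ?m -
          vp_remainder_series n p (\<lambda>k. q ^ k) \<beta> \<phi> x / q ^ ?m)"
    by (intro sums_diff sums_divide vp_remainder_series_sums[OF \<psi> q(2) pn \<phi>]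
        vp_remainder_series_sums[OF power_in_D_set[OF q(1)] q(2) pn \<phi>])
  also have "(\<lambda>j. real (vp_weight n p j) * \<psi> j * rotated_harmonic \<beta> \<phi> j x / \<psi> ?m -
      real (vp_weight n p j) * q ^ j * rotated_harmonic \<beta> \<phi> j x / q ^ ?m) = t"
    by (rule ext) (simp add: t_def left_diff_distrib right_diff_distrib)
  finally have sums: "t sums (vp_remainder_series n p \<psi> \<beta> \<phi> x / \<psi> ?m -
          vp_remainder_series n p (\<lambda>k. q ^ k) \<beta> \<phi> x / q ^ ?m)" .
  have t: "\<bar>t (?m + i)\<bar> \<le> w * (?e * (real i * r ^ (i - 1))) * G"
    if "real (vp_weight n p (?m + i)) \<le> w" for i w
  proof -
    have "q ^ (?m + i) / q ^ ?m = q ^ i" using q by (simp add: power_add)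
    then show ?thesis
      using D_set_ratio_power_diff[OF \<psi> q(1) _ r(3), of i] that G[of "?m + i" x] e0 r(1)
      unfolding t_def abs_mult by (intro mult_mono) (auto intro: order_trans[OF of_nat_0_le_iff])
  qed
  \<comment> \<open>Weights bounded by \<open>p\<close>. The first moment gives the constant 4,
    enlarged to 16 to agree with the other estimate.\<close>
  have 1: "(\<Sum>i<N. \<bar>t (?m + i)\<bar>) \<le> G * (16 * (?e / (1 - q)\<^sup>2) * real p)" for N
  proof -
    have "(\<Sum>i<N. \<bar>t (?m + i)\<bar>) \<le> (\<Sum>i<N. real p * (?e * (real i * r ^ (i - 1))) * G)"
      by (intro sum_mono t) (simp add: vp_weight_le(1)[OF pn(2)])
    also have "\<dots> = G * ?e * real p * (\<Sum>i<N. real i * r ^ (i - 1))"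
      by (simp add: sum_distrib_left mult_ac)
    also have "\<dots> \<le> G * ?e * real p * (1 / (1 - r)\<^sup>2)"
      using G0 e0 by (intro mult_left_mono geometric_moment_bounds(1)[OF r(1,2)]) auto
    also have "\<dots> = G * (4 * (?e / (1 - q)\<^sup>2) * real p)"
      unfolding r(4) using q by (simp add: power_divide field_simps)
    also have "\<dots> \<le> G * (16 * (?e / (1 - q)\<^sup>2) * real p)"
      using G0 e0 by (intro mult_left_mono mult_right_mono) auto
    finally show ?thesis .
  qed
  \<comment> \<open>Weights bounded by \<open>i + 1\<close>. The second moment gives
    \<open>2 / (1 - r)^3 = 16 / (1 - q)^3\<close>.\<close>
  have 2: "(\<Sum>i<N. \<bar>t (?m + i)\<bar>) \<le> G * (16 * (?e / (1 - q)\<^sup>2) * (1 / (1 - q)))" for N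
  proof -
    have "(\<Sum>i<N. \<bar>t (?m + i)\<bar>) \<le> (\<Sum>i<N. real (i + 1) * (?e * (real i * r ^ (i - 1))) * G)"
      by (intro sum_mono t of_nat_mono vp_weight_shift_le pn)
    also have "\<dots> = G * ?e * (\<Sum>i<N. real i * real (i + 1) * r ^ (i - 1))"
      by (simp add: sum_distrib_left mult_ac)
    also have "\<dots> \<le> G * ?e * (2 / (1 - r) ^ 3)"
      using G0 e0 by (intro mult_left_mono geometric_moment_bounds(2)[OF r(1,2)]) auto
    also have "\<dots> = G * (16 * (?e / (1 - q)\<^sup>2) * (1 / (1 - q)))"
      unfolding r(4) by (simp add: power_divide power2_eq_square power3_eq_cube)
    finally show ?thesis .
  qed
  show ?thesis
  proof (rule sums_abs_le[OF sums, of ?m])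
    show "(\<Sum>i<N. \<bar>t (?m + i)\<bar>) \<le> G * (16 * (?e / (1 - q)\<^sup>2) * min (real p) (1 / (1 - q)))" for N
      by (cases "real p \<le> 1 / (1 - q)") (simp_all only: min_def if_True if_False 1 2)
  qed (simp add: t_def vp_weight_eq_0)
qed

lemma class_error_diff:
  assumes \<psi>: "\<psi> \<in> D_set q" and q: "0 < q" "q < 1" and pn: "1 \<le> p" "p \<le> n"
    and zero: "(\<lambda>_. 0) \<in> \<NN>"
    and G: "\<And>\<phi> k x. \<phi> \<in> \<NN> \<Longrightarrow> \<phi> \<in> L_space 1 \<Longrightarrow> k \<ge> n - p + 1 \<Longrightarrow> \<bar>rotated_harmonic \<beta> \<phi> k x\<bar> \<le> G"
    and small: "ratio_dev \<psi> q (n - p + 1) \<le> (1 - q) / 2"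
  shows "\<bar>real p / \<psi> (n - p + 1) * class_error (C_class \<psi> \<beta> \<NN>) n p -
          real p / q ^ (n - p + 1) * class_error (C_class (\<lambda>k. q ^ k) \<beta> \<NN>) n p\<bar>
     \<le> G * (16 * (ratio_dev \<psi> q (n - p + 1) / (1 - q)\<^sup>2) * min (real p) (1 / (1 - q)))"
    (is "_ \<le> ?E")
proof -
  let ?m = "n - p + 1"
  let ?N = "{\<phi> \<in> \<NN>. \<phi> \<in> L_space 1 \<and> fourier_a \<phi> 0 = 0}"
  let ?q = "\<lambda>k. q ^ k"
  note qD = power_in_D_set[OF q(1)]
  have bd: "\<exists>B. \<forall>\<phi>\<in>?N. \<forall>x. \<bar>vp_remainder_series n p \<psi> \<beta> \<phi> x / real p\<bar> \<le> B"
    if "\<psi> \<in> D_set q" for \<psi>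
  proof (intro exI ballI allI)
    fix \<phi> x assume "\<phi> \<in> ?N"
    then have "\<bar>vp_remainder_series n p \<psi> \<beta> \<phi> x\<bar> \<le> real p * G * (\<Sum>i. \<psi> (n - p + 1 + i))"
      by (intro abs_vp_remainder_series_le[OF that q(2) pn] G) auto
    then show "\<bar>vp_remainder_series n p \<psi> \<beta> \<phi> x / real p\<bar> \<le> G * (\<Sum>i. \<psi> (n - p + 1 + i))"
      using pn by (simp add: field_simps)
  qed
  have bdd_x: "bdd_above (range (\<lambda>x. \<bar>vp_remainder_series n p \<psi> \<beta> \<phi> x / real p\<bar>))"
    if D: "\<psi> \<in> D_set q" and N: "\<phi> \<in> ?N" for \<psi> \<phi>
  proof -
    obtain B where "\<forall>\<phi>\<in>?N. \<forall>x. \<bar>vp_remainder_series n p \<psi> \<beta> \<phi> x / real p\<bar> \<le> B"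
      using bd[OF D] by blast
    then show ?thesis using N by (intro bdd_aboveI2[where M = B]) blast
  qed
  have bdd_\<phi>: "bdd_above ((\<lambda>\<phi>. C_norm (\<lambda>x. vp_remainder_series n p \<psi> \<beta> \<phi> x / real p)) ` ?N)"
    if D: "\<psi> \<in> D_set q" for \<psi>
  proof -
    obtain B where B: "\<forall>\<phi>\<in>?N. \<forall>x. \<bar>vp_remainder_series n p \<psi> \<beta> \<phi> x / real p\<bar> \<le> B"
      using bd[OF D] by blast
    then show ?thesis
      by (intro bdd_aboveI2[where M = B]) (auto simp only: C_norm_def intro!: cSUP_least)
  qed
  have cpos: "real p / \<psi> ?m > 0" "real p / q ^ ?m > 0"
    using pn q D_set_pos[OF \<psi>] by auto
  \<comment> \<open>The comparison of real suprema requires a nonempty set; the zero function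
    provides an element.\<close>
  have ne: "?N \<noteq> {}"
  proof -
    have "(\<lambda>_. 0) \<in> C_space" by (simp add: C_space_def periodic_2pi_def)
    then have "(\<lambda>_. 0) \<in> ?N" using zero C_space_subset_L_space_1 by (auto simp: fourier_a_def)
    then show ?thesis by blast
  qed
  show ?thesis
    unfolding class_error_C_class[OF \<psi> q(2) pn] class_error_C_class[OF qD q(2) pn]
  proof (rule SUP_scaled_diff_le[OF ne cpos bdd_\<phi>[OF \<psi>] bdd_\<phi>[OF qD]])
    fix \<phi> assume \<phi>: "\<phi> \<in> ?N"
    show "\<bar>real p / \<psi> ?m * C_norm (\<lambda>x. vp_remainder_series n p \<psi> \<beta> \<phi> x / real p) -
       real p / q ^ ?m * C_norm (\<lambda>x. vp_remainder_series n p ?q \<beta> \<phi> x / real p)\<bar> \<le> ?E"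
      \<comment> \<open>The norms are themselves suprema, so the comparison lemma applies once more,
        now over \<open>x\<close>.\<close>
      unfolding C_norm_def
    proof (rule SUP_scaled_diff_le[OF _ cpos bdd_x[OF \<psi> \<phi>] bdd_x[OF qD \<phi>]])
      fix x
      let ?X = "vp_remainder_series n p \<psi> \<beta> \<phi> x" and ?Y = "vp_remainder_series n p ?q \<beta> \<phi> x"
      have "real p / \<psi> ?m * \<bar>?X / real p\<bar> = \<bar>?X / \<psi> ?m\<bar>" "real p / q ^ ?m * \<bar>?Y / real p\<bar> = \<bar>?Y / q ^ ?m\<bar>"
        using pn q D_set_pos[OF \<psi>, of ?m] by (simp_all add: abs_divide)
      then have "\<bar>real p / \<psi> ?m * \<bar>?X / real p\<bar> - real p / q ^ ?m * \<bar>?Y / real p\<bar>\<bar> \<le> \<bar>?X / \<psi> ?m - ?Y / q ^ ?m\<bar>"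
        by (simp only: abs_triangle_ineq3)
      also have "\<dots> \<le> ?E"
        using \<phi> by (intro vp_remainder_series_diff[OF \<psi> q pn _ _ _ small] G) auto
      finally show "\<bar>real p / \<psi> ?m * \<bar>?X / real p\<bar> - real p / q ^ ?m * \<bar>?Y / real p\<bar>\<bar> \<le> ?E" .
    qed simp
  qed
qed

text \<open>Here \<open>W\<close> is the scale of the class: \<open>1\<close> for
  \<open>U0 s\<close> and \<open>\<omega> (1 / (n - p + 1))\<close> for
  \<open>H_class \<omega>\<close>. The constant is \<open>128 = 8 * 16\<close>.\<close>

lemma class_error_asymptotics:
  assumes \<psi>: "\<psi> \<in> D_set q" and q: "0 < q" "q < 1" and pn: "1 \<le> p" "p \<le> n"
    and zero: "(\<lambda>_. 0) \<in> \<NN>"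
    and G: "\<And>\<phi> k x. \<phi> \<in> \<NN> \<Longrightarrow> \<phi> \<in> L_space 1 \<Longrightarrow> k \<ge> n - p + 1 \<Longrightarrow> \<bar>rotated_harmonic \<beta> \<phi> k x\<bar> \<le> 8 * W"
    and small: "ratio_dev \<psi> q (n - p + 1) \<le> (1 - q) / 2"
  shows "\<exists>c. \<bar>c\<bar> \<le> 128 \<and>
          class_error (C_class \<psi> \<beta> \<NN>) n p =
            \<psi> (n - p + 1) / real p *
            (real p * class_error (C_class (\<lambda>k. q ^ k) \<beta> \<NN>) n p / q ^ (n - p + 1) +
             c * W * (ratio_dev \<psi> q (n - p + 1) / (1 - q)\<^sup>2) * min (real p) (1 / (1 - q)))"
proof -
  let ?m = "n - p + 1"
  define Q where "Q = W * (ratio_dev \<psi> q ?m / (1 - q)\<^sup>2) * min (real p) (1 / (1 - q))"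
  define E where "E = class_error (C_class \<psi> \<beta> \<NN>) n p"
  define F where "F = class_error (C_class (\<lambda>k. q ^ k) \<beta> \<NN>) n p"
  define X where "X = real p / \<psi> ?m * E - real p / q ^ ?m * F"
  have X: "\<bar>X\<bar> \<le> 128 * Q"
    using class_error_diff[OF \<psi> q pn zero G small] by (simp add: X_def E_def F_def Q_def mult_ac)
  \<comment> \<open>If \<open>Q = 0\<close>, the estimate forces \<open>X = 0\<close>, so the value
    \<open>0\<close> is correct there too.\<close>
  define c where "c = (if Q = 0 then 0 else X / Q)"
  have cQ: "X = c * Q" using X by (auto simp: c_def)
  have "\<bar>c\<bar> \<le> 128" using X by (auto simp: c_def abs_divide divide_le_eq)
  moreover have "E = \<psi> ?m / real p * (real p * F / q ^ ?m + c * Q)"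
    unfolding cQ[symmetric] X_def using pn D_set_pos[OF \<psi>, of ?m] by (simp add: field_simps)
  ultimately show ?thesis
    unfolding E_def F_def Q_def by (auto simp: mult.assoc intro!: exI[of _ c])
qed

subsection \<open>Bounds for the harmonics of the two classes\<close>

lemma zero_in_U0:
  assumes "1 \<le> s"
  shows "(\<lambda>_. 0) \<in> U0 s"
proof -
  \<comment> \<open>For \<open>s = \<infinity>\<close> the essential supremum of a constant is that
    constant because the whole space is not null.\<close>
  have "emeasure (lebesgue :: real measure) (space lebesgue) \<noteq> 0" by simp
  then have "esssup lebesgue (\<lambda>t::real. 0 :: ereal) = 0" by (rule esssup_const)
  then show ?thesis
    using assms by (auto simp: U0_def L_space_def L_norm_def periodic_2pi_def zero_ereal_def)
qed

text \<open>For finite \<open>s\<close> the pointwise inequality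
  \<open>\<bar>y\<bar> \<le> 1 + \<bar>y\<bar> powr r\<close> with \<open>r \<ge> 1\<close>,
  integrated over a period, gives a bound uniform in \<open>s\<close>. For
  \<open>s = \<infinity>\<close> the function is at most \<open>1\<close> almost everywhere.\<close>

lemma U0_integral_abs_le:
  assumes s: "1 \<le> s" and \<phi>: "\<phi> \<in> U0 s" "\<phi> \<in> L_space 1"
  shows "(\<integral>t. \<bar>\<phi> t\<bar> \<partial>lebesgue_on {0..2 * pi}) \<le> 2 * pi + 1"
proof -
  let ?M = "lebesgue_on {0..2 * pi}"
  have int: "integrable ?M (\<lambda>t. \<bar>\<phi> t\<bar>)" by (rule L_space_1_integrable[OF \<phi>(2)])
  have const: "integrable ?M (\<lambda>t. 1 :: real)" "(\<integral>t. 1 \<partial>?M) = 2 * pi"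
    by (simp_all add: measure_restrict_space lebesgue_on_UNIV_eq)
  show ?thesis
  proof (cases "s = \<infinity>")
    case True
    let ?e = "esssup lebesgue (\<lambda>t. ereal \<bar>\<phi> t\<bar>)"
    have e: "?e < \<infinity>" "real_of_ereal ?e \<le> 1"
      using \<phi>(1) True by (auto simp: U0_def L_space_def L_norm_def)
    have "AE t in lebesgue. ereal \<bar>\<phi> t\<bar> \<le> ?e" by (rule esssup_AE)
    then have "AE t in lebesgue. \<bar>\<phi> t\<bar> \<le> 1"
    proof eventually_elim
      fix t assume "ereal \<bar>\<phi> t\<bar> \<le> ?e"
      then show "\<bar>\<phi> t\<bar> \<le> 1" using e by (cases ?e) auto
    qed
    then have "AE t in ?M. \<bar>\<phi> t\<bar> \<le> 1"
      by (subst AE_restrict_space_iff) auto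
    then have "(\<integral>t. \<bar>\<phi> t\<bar> \<partial>?M) \<le> (\<integral>t. 1 \<partial>?M)"
      by (intro integral_mono_AE int const)
    then show ?thesis using const by simp
  next
    case False
    then obtain r where r: "s = ereal r" "r \<ge> 1" using s by (cases s) auto
    have intr: "integrable ?M (\<lambda>t. \<bar>\<phi> t\<bar> powr r)"
      and norm: "(\<integral>t. \<bar>\<phi> t\<bar> powr r \<partial>?M) powr (1 / r) \<le> 1"
      using \<phi>(1) r by (auto simp: U0_def L_space_def L_norm_def)
    have I: "(\<integral>t. \<bar>\<phi> t\<bar> powr r \<partial>?M) \<le> 1"
    proof (rule ccontr)
      assume "\<not> ?thesis"
      then have "1 < (\<integral>t. \<bar>\<phi> t\<bar> powr r \<partial>?M) powr (1 / r)"
        using r by (intro gr_one_powr) auto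
      then show False using norm by simp
    qed
    have "\<bar>\<phi> t\<bar> \<le> 1 + \<bar>\<phi> t\<bar> powr r" for t
    proof (cases "\<bar>\<phi> t\<bar> \<le> 1")
      case False
      then have "\<bar>\<phi> t\<bar> powr 1 \<le> \<bar>\<phi> t\<bar> powr r" using r by (intro powr_mono) auto
      then show ?thesis by simp
    qed (simp add: add_increasing2)
    then have "(\<integral>t. \<bar>\<phi> t\<bar> \<partial>?M) \<le> (\<integral>t. 1 + \<bar>\<phi> t\<bar> powr r \<partial>?M)"
      by (intro integral_mono int Bochner_Integration.integrable_add const intr)
    also have "\<dots> = 2 * pi + (\<integral>t. \<bar>\<phi> t\<bar> powr r \<partial>?M)"
      using const intr by simp
    finally show ?thesis using I by simp
  qed
qed

text \<open>Each of the two coefficients is at most \<open>2 + 1 / pi\<close>, rounded up to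
  4.\<close>

lemma U0_rotated_harmonic_le:
  assumes "1 \<le> s" "\<phi> \<in> U0 s" "\<phi> \<in> L_space 1"
  shows "\<bar>rotated_harmonic \<beta> \<phi> k x\<bar> \<le> 8"
proof -
  have "(1 / pi) * (\<integral>t. \<bar>\<phi> t\<bar> \<partial>lebesgue_on {0..2 * pi}) \<le> (1 / pi) * (2 * pi + 1)"
    by (intro mult_left_mono U0_integral_abs_le[OF assms]) auto
  also have "\<dots> \<le> 4" using pi_gt3 by (simp add: field_simps)
  finally show ?thesis
    using abs_rotated_harmonic_le[of \<beta> \<phi> k x] abs_fourier_le[OF assms(3), of k] by linarith
qed

section \<open>Harmonics of functions with a prescribed modulus of continuity\<close>

lemma integral_periodic_shift:
  assumes g: "g \<in> C_space" and h: "0 \<le> h" "h \<le> 2 * pi"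
  shows "integral {0..2 * pi} (\<lambda>t. g (h + t)) = integral {0..2 * pi} g"
proof -
  have shift: "integral {a..b} (\<lambda>t. g (c + t)) = integral {a + c..b + c} g" for a b c
    using integral_shift_Icc_real[of a b g c] by (simp add: o_def)
  have int: "g integrable_on {a..b}" for a b
    by (intro integrable_continuous_real C_space_continuous_on[OF g])
  have "g (2 * pi + t) = g t" for t
    using C_space_periodic[OF g] by (simp add: periodic_2pi_def add.commute)
  then have "integral {2 * pi..2 * pi + h} g = integral {0..h} g"
    using shift[of 0 h "2 * pi"] by (simp add: add.commute)
  moreover have "integral {h..2 * pi} g + integral {2 * pi..2 * pi + h} g = integral {h..2 * pi + h} g"
    using h by (intro Henstock_Kurzweil_Integration.integral_combine int) auto
  moreover have "integral {0..h} g + integral {h..2 * pi} g = integral {0..2 * pi} g"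
    using h by (intro Henstock_Kurzweil_Integration.integral_combine int) auto
  ultimately show ?thesis using shift[of 0 "2 * pi" h] by (simp add: add.commute)
qed

text \<open>Shifting by \<open>\<pi>/k\<close> flips the sign of the \<open>k\<close>-th harmonic.\<close>

lemma abs_integral_harmonic_le:
  assumes \<phi>: "\<phi> \<in> C_space" and k: "k \<ge> 1"
    and w: "\<And>t. \<bar>\<phi> t - \<phi> (pi / real k + t)\<bar> \<le> w"
    and e: "e \<in> C_space" "\<And>t. \<bar>e t\<bar> \<le> 1" "\<And>t. e (pi / real k + t) = - e t"
  shows "\<bar>(1 / pi) * integral {0..2 * pi} (\<lambda>t. \<phi> t * e t)\<bar> \<le> w"
proof -
  let ?h = "pi / real k"
  let ?I = "integral {0..2 * pi} (\<lambda>t. \<phi> t * e t)"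
  have h: "0 \<le> ?h" "?h \<le> 2 * pi" using k by (auto simp: field_simps)
  note co = C_space_continuous_on[OF \<phi>] C_space_continuous_on[OF e(1)]
  have cs: "continuous_on S (\<lambda>t. \<phi> (?h + t))" for S
    by (rule continuous_on_compose2[OF C_space_continuous_on[OF \<phi>, of UNIV]]) (auto intro!: continuous_intros)
  have "(\<lambda>t. \<phi> t * e t) \<in> C_space"
    using \<phi> e(1) by (auto simp: C_space_def periodic_2pi_def intro: continuous_intros)
  from integral_periodic_shift[OF this h]
  have "?I = integral {0..2 * pi} (\<lambda>t. - (\<phi> (?h + t) * e t))" by (simp add: e(3))
  \<comment> \<open>Adding the integral to its shifted form replaces \<open>\<phi>\<close> by an
    increment; the resulting factor 2 offsets the period length \<open>2 * pi\<close> against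
    \<open>1 / pi\<close>.\<close>
  then have "2 * ?I = ?I + integral {0..2 * pi} (\<lambda>t. - (\<phi> (?h + t) * e t))" by simp
  also have "\<dots> = integral {0..2 * pi} (\<lambda>t. \<phi> t * e t + - (\<phi> (?h + t) * e t))"
    by (rule integral_add[symmetric]) (intro integrable_continuous_real continuous_intros co cs)+
  also have "\<dots> = integral {0..2 * pi} (\<lambda>t. (\<phi> t - \<phi> (?h + t)) * e t)"
    by (simp add: algebra_simps)
  finally have 2: "2 * ?I = integral {0..2 * pi} (\<lambda>t. (\<phi> t - \<phi> (?h + t)) * e t)" .
  have "norm (integral {0..2 * pi} (\<lambda>t. (\<phi> t - \<phi> (?h + t)) * e t)) \<le> w * (2 * pi - 0)"
  proof (rule integral_bound)
    show "continuous_on {0..2 * pi} (\<lambda>t. (\<phi> t - \<phi> (?h + t)) * e t)"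
      by (intro continuous_intros co cs)
    show "norm ((\<phi> t - \<phi> (?h + t)) * e t) \<le> w" for t
      using mult_mono[OF w[of t] e(2)[of t]] w[of t] by (simp add: abs_mult)
  qed simp
  then have "2 * \<bar>?I\<bar> \<le> w * (2 * pi)" unfolding 2[symmetric] by simp
  then show ?thesis by (simp add: abs_mult field_simps)
qed

text \<open>Boundedness of \<open>\<phi>\<close> makes both nested suprema, over \<open>x\<close>
  and over the shift, genuine upper bounds.\<close>

lemma H_class_increment_le:
  assumes "\<phi> \<in> H_class \<omega>"
  shows "\<bar>\<phi> (x + h) - \<phi> x\<bar> \<le> \<omega> \<bar>h\<bar>"
proof -
  have \<phi>: "\<phi> \<in> C_space" and mod: "modulus_of \<phi> \<bar>h\<bar> \<le> \<omega> \<bar>h\<bar>"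
    using assms by (auto simp: H_class_def)
  obtain B where B: "\<And>x. \<bar>\<phi> x\<bar> \<le> B" using C_space_bounded[OF \<phi>] by blast
  have d: "\<bar>\<phi> (x + h) - \<phi> x\<bar> \<le> 2 * B" for x h
    using B[of x] B[of "x + h"] by linarith
  have "\<bar>\<phi> (x + h) - \<phi> x\<bar> \<le> C_norm (\<lambda>x. \<phi> (x + h) - \<phi> x)"
    unfolding C_norm_def by (rule cSUP_upper) (auto intro!: bdd_aboveI2[where M = "2 * B"] d)
  also have "\<dots> \<le> modulus_of \<phi> \<bar>h\<bar>"
    unfolding modulus_of_def
  proof (rule cSUP_upper)
    have "C_norm (\<lambda>x. \<phi> (x + h) - \<phi> x) \<le> 2 * B" for h
      unfolding C_norm_def by (rule cSUP_least) (auto intro: d)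
    then show "bdd_above ((\<lambda>h. C_norm (\<lambda>x. \<phi> (x + h) - \<phi> x)) ` {h'. \<bar>h'\<bar> \<le> \<bar>h\<bar>})"
      by (intro bdd_aboveI2[where M = "2 * B"])
  qed simp
  finally show ?thesis using mod by linarith
qed

lemma modulus_of_continuity_nonneg:
  assumes "is_modulus_of_continuity \<omega>" "t \<ge> 0"
  shows "\<omega> t \<ge> 0"
proof -
  have "\<omega> 0 \<le> \<omega> t"
    using assms by (intro mono_onD[of "{0..}" \<omega>]) (auto simp: is_modulus_of_continuity_def)
  then show ?thesis using assms(1) by (simp add: is_modulus_of_continuity_def)
qed

lemma zero_in_H_class:
  assumes "is_modulus_of_continuity \<omega>"
  shows "(\<lambda>_. 0) \<in> H_class \<omega>"
proof -
  have "modulus_of (\<lambda>_. 0) t = 0" if "t \<ge> 0" for t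
  proof -
    have "{h. \<bar>h\<bar> \<le> t} \<noteq> {}" using that by (auto intro!: exI[of _ 0])
    then show ?thesis by (simp add: modulus_of_def C_norm_def)
  qed
  then show ?thesis
    using modulus_of_continuity_nonneg[OF assms]
    by (auto simp: H_class_def C_space_def periodic_2pi_def)
qed

text \<open>Since \<open>pi < 4\<close>, monotonicity and two doublings by subadditivity
  suffice.\<close>

lemma modulus_of_continuity_pi_div_le:
  assumes \<omega>: "is_modulus_of_continuity \<omega>" and k: "1 \<le> m" "m \<le> k"
  shows "\<omega> (pi / real k) \<le> 4 * \<omega> (1 / real m)"
proof -
  let ?u = "1 / real m"
  have mono: "mono_on {0..} \<omega>" and sub: "\<And>s t. s \<ge> 0 \<Longrightarrow> t \<ge> 0 \<Longrightarrow> \<omega> (s + t) \<le> \<omega> s + \<omega> t"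
    using \<omega> by (auto simp: is_modulus_of_continuity_def)
  have "pi / real k \<le> 4 / real m"
    using k pi_less_4 by (intro frac_le) auto
  also have "4 / real m = (?u + ?u) + (?u + ?u)" by simp
  finally have "\<omega> (pi / real k) \<le> \<omega> ((?u + ?u) + (?u + ?u))"
    by (intro mono_onD[OF mono]) auto
  also have "\<dots> \<le> \<omega> (?u + ?u) + \<omega> (?u + ?u)" by (rule sub) auto
  also have "\<dots> \<le> (\<omega> ?u + \<omega> ?u) + (\<omega> ?u + \<omega> ?u)" by (intro add_mono sub) auto
  finally show ?thesis by simp
qed

text \<open>Both \<open>cos\<close> and \<open>sin\<close> of \<open>k * t\<close> change sign under
  the shift by \<open>pi / k\<close>, so each coefficient is at most
  \<open>\<omega> (pi / k) \<le> 4 * \<omega> (1 / m)\<close>.\<close>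

lemma H_class_rotated_harmonic_le:
  assumes \<omega>: "is_modulus_of_continuity \<omega>" and \<phi>: "\<phi> \<in> H_class \<omega>" and k: "1 \<le> m" "m \<le> k"
  shows "\<bar>rotated_harmonic \<beta> \<phi> k x\<bar> \<le> 8 * \<omega> (1 / real m)"
proof -
  have C: "\<phi> \<in> C_space" using \<phi> by (simp add: H_class_def)
  have k1: "k \<ge> 1" using k by simp
  have w: "\<bar>\<phi> t - \<phi> (pi / real k + t)\<bar> \<le> \<omega> (pi / real k)" for t
    using H_class_increment_le[OF \<phi>, of t "pi / real k"] by (simp add: abs_minus_commute add.commute)
  have per: "real k * (t + 2 * pi) = real k * t + 2 * real k * pi" for t by (simp add: algebra_simps)
  have sh: "real k * (pi / real k + t) = pi + real k * t" for t using k1 by (simp add: field_simps)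
  have "\<bar>fourier_a \<phi> k\<bar> \<le> \<omega> (pi / real k)"
    unfolding fourier_a_C_space[OF C]
    by (rule abs_integral_harmonic_le[OF C k1 w])
       (auto simp: C_space_def periodic_2pi_def per sh cos_add intro!: continuous_intros)
  moreover have "\<bar>fourier_b \<phi> k\<bar> \<le> \<omega> (pi / real k)"
    unfolding fourier_b_C_space[OF C]
    by (rule abs_integral_harmonic_le[OF C k1 w])
       (auto simp: C_space_def periodic_2pi_def per sh sin_add intro!: continuous_intros)
  ultimately show ?thesis
    using abs_rotated_harmonic_le[of \<beta> \<phi> k x] modulus_of_continuity_pi_div_le[OF \<omega> k] by linarith
qed

text \<open>The threshold \<open>N\<close> only has to ensure
  \<open>ratio_dev \<le> (1 - q) / 2\<close>. This condition involves \<open>\<psi>\<close> and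
  \<open>q\<close> alone, so one \<open>N\<close> serves both classes and all \<open>s\<close>,
  \<open>\<beta>\<close>, \<open>\<omega>\<close>.\<close>

theorem theorem1:
  "\<exists>K::real. \<forall>q\<in>{0<..<1::real}. \<forall>\<psi>\<in>D_set q. \<exists>N::nat.
     \<forall>(n::nat) (p::nat) (s::ereal) (\<beta>::real) (\<omega>::real \<Rightarrow> real).
       1 \<le> p \<and> p \<le> n \<and> N \<le> n - p \<and> 1 \<le> s \<and> is_modulus_of_continuity \<omega> \<longrightarrow>
       (\<exists>c. \<bar>c\<bar> \<le> K \<and>
          class_error (C_class \<psi> \<beta> (U0 s)) n p =
            \<psi> (n - p + 1) / real p *
            (real p * class_error (C_class (\<lambda>k. q ^ k) \<beta> (U0 s)) n p / q ^ (n - p + 1) +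
             c * (ratio_dev \<psi> q (n - p + 1) / (1 - q)\<^sup>2) * min (real p) (1 / (1 - q)))) \<and>
       (\<exists>c. \<bar>c\<bar> \<le> K \<and>
          class_error (C_class \<psi> \<beta> (H_class \<omega>)) n p =
            \<psi> (n - p + 1) / real p *
            (real p * class_error (C_class (\<lambda>k. q ^ k) \<beta> (H_class \<omega>)) n p / q ^ (n - p + 1) +
             c * \<omega> (1 / real (n - p + 1)) * (ratio_dev \<psi> q (n - p + 1) / (1 - q)\<^sup>2)
               * min (real p) (1 / (1 - q))))"
proof (rule exI[of _ 128], intro ballI)
  fix q :: real and \<psi> assume "q \<in> {0<..<1}" and \<psi>: "\<psi> \<in> D_set q"
  then have q: "0 < q" "q < 1" and "(1 - q) / 2 > 0" by auto
  obtain N where N: "\<And>m. m \<ge> N \<Longrightarrow> ratio_dev \<psi> q m \<le> (1 - q) / 2"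
    using ratio_dev_eventually_le[OF \<psi> \<open>(1 - q) / 2 > 0\<close>] by blast
  show "\<exists>N::nat. \<forall>(n::nat) (p::nat) (s::ereal) (\<beta>::real) (\<omega>::real \<Rightarrow> real).
       1 \<le> p \<and> p \<le> n \<and> N \<le> n - p \<and> 1 \<le> s \<and> is_modulus_of_continuity \<omega> \<longrightarrow>
       (\<exists>c. \<bar>c\<bar> \<le> 128 \<and>
          class_error (C_class \<psi> \<beta> (U0 s)) n p =
            \<psi> (n - p + 1) / real p *
            (real p * class_error (C_class (\<lambda>k. q ^ k) \<beta> (U0 s)) n p / q ^ (n - p + 1) +
             c * (ratio_dev \<psi> q (n - p + 1) / (1 - q)\<^sup>2) * min (real p) (1 / (1 - q)))) \<and>
       (\<exists>c. \<bar>c\<bar> \<le> 128 \<and>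
          class_error (C_class \<psi> \<beta> (H_class \<omega>)) n p =
            \<psi> (n - p + 1) / real p *
            (real p * class_error (C_class (\<lambda>k. q ^ k) \<beta> (H_class \<omega>)) n p / q ^ (n - p + 1) +
             c * \<omega> (1 / real (n - p + 1)) * (ratio_dev \<psi> q (n - p + 1) / (1 - q)\<^sup>2)
               * min (real p) (1 / (1 - q))))"
  proof (rule exI[of _ N], intro allI impI, elim conjE, rule conjI)
    fix n p :: nat and s :: ereal and \<beta> :: real and \<omega> :: "real \<Rightarrow> real"
    assume pn: "1 \<le> p" "p \<le> n" and "N \<le> n - p" and s: "1 \<le> s" and \<omega>: "is_modulus_of_continuity \<omega>"
    then have small: "ratio_dev \<psi> q (n - p + 1) \<le> (1 - q) / 2" by (intro N) simp
    show "\<exists>c. \<bar>c\<bar> \<le> 128 \<and>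
          class_error (C_class \<psi> \<beta> (U0 s)) n p =
            \<psi> (n - p + 1) / real p *
            (real p * class_error (C_class (\<lambda>k. q ^ k) \<beta> (U0 s)) n p / q ^ (n - p + 1) +
             c * (ratio_dev \<psi> q (n - p + 1) / (1 - q)\<^sup>2) * min (real p) (1 / (1 - q)))"
      using class_error_asymptotics[OF \<psi> q pn zero_in_U0[OF s] _ small, of \<beta> 1]
        U0_rotated_harmonic_le[OF s] by simp
    show "\<exists>c. \<bar>c\<bar> \<le> 128 \<and>
          class_error (C_class \<psi> \<beta> (H_class \<omega>)) n p =
            \<psi> (n - p + 1) / real p *
            (real p * class_error (C_class (\<lambda>k. q ^ k) \<beta> (H_class \<omega>)) n p / q ^ (n - p + 1) +
             c * \<omega> (1 / real (n - p + 1)) * (ratio_dev \<psi> q (n - p + 1) / (1 - q)\<^sup>2)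
               * min (real p) (1 / (1 - q)))"
      by (rule class_error_asymptotics[OF \<psi> q pn zero_in_H_class[OF \<omega>] _ small])
         (rule H_class_rotated_harmonic_le[OF \<omega>], auto)
  qed
qed

end
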